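(* Let $K\in End_{\mathcal A}^{*}(\mathcal H)$. For $k=1,\dots,n$ let $\{T_{k,w}\}_{w\in\Omega}\subset End_{\mathcal A}^{*}(\mathcal H)$ be a continuous $K$-operator frame for $End_{\mathcal A}^{*}(\mathcal H)$ with bounds $A_k$ and $B_k$, and let $\{R_{k,w}\}_{w\in\Omega}\subset End_{\mathcal A}^{*}(\mathcal H)$ be any family. Let $S:l^2(\mathcal H)\to l^2(\mathcal H)$ be a bounded linear operator such that, for some $p\in\{1,\dots,n\}$, $$S\Big(\Big\{\sum_{k=1}^nR_{k,w}x\Big\}_{w\in\Omega}\Big)=\{T_{p,w}x\}_{w\in\Omega}\qquad\text{for all }x\in\mathcal H.$$ If there exists a constant $\lambda>0$ such that for all $x\in\mathcal H$ and $k=1,\dots,n$ $$\Big\|\int_\Omega\langle(T_{k,w}-R_{k,w})x,(T_{k,w}-R_{k,w})x\rangle_{\mathcal A}\,d\mu(w)\Big\|\le\lambda\Big\|\int_\Omega\langle T_{k,w}x,T_{k,w}x\rangle_{\mathcal A}\,d\mu(w)\Big\|,$$ then $\{\sum_{k=1}^nR_{k,w}\}_{w\in\Omega}$ is a continuous $K$-operator frame for $End_{\mathcal A}^{*}(\mathcal H)$.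
   Context: $\mathcal A$ is a unital $C^*$-algebra, $\mathcal H$ is a (left) Hilbert $\mathcal A$-module with $\mathcal A$-valued inner product $\langle\cdot,\cdot\rangle_{\mathcal A}$ ($\mathcal A$-linear in the first variable) and norm $\|x\|=\|\langle x,x\rangle_{\mathcal A}\|^{1/2}$, and $End_{\mathcal A}^{*}(\mathcal H)$ is the set of adjointable operators $\mathcal H\to\mathcal H$. $(\Omega,\mu)$ is a measure space; integrals of Banach-space-valued functions are Bochner integrals. Inequalities between elements of $\mathcal A$ refer to the order given by the positive cone $\mathcal A^+$. $l^2(\mathcal H)$ denotes the space of (measurable) families $\{x_w\}_{w\in\Omega}$ in $\mathcal H$ with $\big\|\int_\Omega\langle x_w,x_w\rangle_{\mathcal A}\,d\mu(w)\big\|<\infty$, with $\mathcal A$-valued inner product $\langle x,y\rangle=\int_\Omega\langle x_w,y_w\rangle_{\mathcal A}\,d\mu(w)$ and norm $\|\{x_w\}_{w\in\Omega}\|=\|\langle x,x\rangle\|^{1/2}$ (families equal almost everywhere being identified). For $K\in End_{\mathcal A}^{*}(\mathcal H)$, a family $\{T_w\}_{w\in\Omega}\subset End_{\mathcal A}^{*}(\mathcal H)$ is a continuous $K$-operator frame for $End_{\mathcal A}^{*}(\mathcal H)$ with (lower and upper) bounds $A,B>0$ if for every $x\in\mathcal H$, $A\langle K^*x,K^*x\rangle_{\mathcal A}\le\int_\Omega\langle T_wx,T_wx\rangle_{\mathcal A}\,d\mu(w)\le B\langle x,x\rangle_{\mathcal A}$. It is called a continuous $K$-operator frame if such $A,B>0$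 exist. Convention: for all families of operators considered, $w\mapsto T_{k,w}x$ and $w\mapsto R_{k,w}x$ are measurable for each $x\in\mathcal H$, and an inequality involving integrals includes the assertion that these integrals exist. *)

theory Defs
  imports "HOL-Analysis.Analysis"
begin

section \<open>Unital C*-algebras\<close>

class complex_normed_space = real_normed_vector +
  fixes scaleC :: "complex \<Rightarrow> 'a \<Rightarrow> 'a"  (infixr \<open>*\<^sub>C\<close> 75)
  assumes scaleC_add_right: "c *\<^sub>C (x + y) = c *\<^sub>C x + c *\<^sub>C y"
    and scaleC_add_left: "(c + d) *\<^sub>C x = c *\<^sub>C x + d *\<^sub>C x"
    and scaleC_scaleC: "c *\<^sub>C d *\<^sub>C x = (c * d) *\<^sub>C x"
    and scaleC_of_real: "complex_of_real r *\<^sub>C x = r *\<^sub>R x"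
    and norm_scaleC: "norm (c *\<^sub>C x) = cmod c * norm x"

text \<open>The zero algebra is not excluded (hence \<open>monoid_mult\<close> rather than
  \<open>real_normed_algebra_1\<close>, which would force \<open>0 \<noteq> 1\<close>).\<close>

class unital_cstar_algebra = complex_normed_space + real_normed_algebra + banach + monoid_mult +
  fixes star :: "'a \<Rightarrow> 'a"
  assumes mult_scaleC_left: "(c *\<^sub>C a) * b = c *\<^sub>C (a * b)"
    and mult_scaleC_right: "a * (c *\<^sub>C b) = c *\<^sub>C (a * b)"
    and star_add: "star (a + b) = star a + star b"
    and star_scaleC: "star (c *\<^sub>C a) = cnj c *\<^sub>C star a"
    and star_mult: "star (a * b) = star b * star a"
    and star_star: "star (star a) = a"
    and cstar_identity: "norm (star a * a) = (norm a)\<^sup>2"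

definition cstar_spectrum :: "'a::unital_cstar_algebra \<Rightarrow> complex set" where
  "cstar_spectrum a = {z. \<not> (\<exists>b. b * (a - z *\<^sub>C 1) = 1 \<and> (a - z *\<^sub>C 1) * b = 1)}"

definition cstar_positive :: "'a::unital_cstar_algebra \<Rightarrow> bool" where
  "cstar_positive a \<longleftrightarrow> star a = a \<and> cstar_spectrum a \<subseteq> complex_of_real ` {0..}"

definition cstar_le :: "'a::unital_cstar_algebra \<Rightarrow> 'a \<Rightarrow> bool"  (infix \<open>\<le>\<^sub>A\<close> 50) where
  "a \<le>\<^sub>A b \<longleftrightarrow> cstar_positive (b - a)"


section \<open>Hilbert modules and adjointable operators\<close>

text \<open>Completeness of the module is part of the sort constraint \<open>banach\<close> on its type.\<close>

locale hilbert_module =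
  fixes act :: "'a::unital_cstar_algebra \<Rightarrow> 'h::{complex_normed_space, banach} \<Rightarrow> 'h"
    and ip :: "'h \<Rightarrow> 'h \<Rightarrow> 'a"
  assumes act_add_right: "act a (x + y) = act a x + act a y"
    and act_add_left: "act (a + b) x = act a x + act b x"
    and act_act: "act a (act b x) = act (a * b) x"
    and act_one: "act 1 x = x"
    and act_scaleC_left: "act (c *\<^sub>C a) x = c *\<^sub>C act a x"
    and act_scaleC_right: "act a (c *\<^sub>C x) = c *\<^sub>C act a x"
    and ip_add_left: "ip (x + y) z = ip x z + ip y z"
    and ip_scaleC_left: "ip (c *\<^sub>C x) y = c *\<^sub>C ip x y"
    and ip_act_left: "ip (act a x) y = a * ip x y"
    and ip_star: "star (ip x y) = ip y x"
    and ip_positive: "cstar_positive (ip x x)"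
    and ip_definite: "ip x x = 0 \<Longrightarrow> x = 0"
    and norm_ip: "norm x = sqrt (norm (ip x x))"

definition is_module_adjoint :: "('h \<Rightarrow> 'h \<Rightarrow> 'a) \<Rightarrow> ('h \<Rightarrow> 'h) \<Rightarrow> ('h \<Rightarrow> 'h) \<Rightarrow> bool" where
  "is_module_adjoint ip T T' \<longleftrightarrow> (\<forall>x y. ip (T x) y = ip x (T' y))"

definition adjointables :: "('h \<Rightarrow> 'h \<Rightarrow> 'a) \<Rightarrow> ('h \<Rightarrow> 'h) set" where
  "adjointables ip = {T. \<exists>T'. is_module_adjoint ip T T'}"

definition module_adjoint :: "('h \<Rightarrow> 'h \<Rightarrow> 'a) \<Rightarrow> ('h \<Rightarrow> 'h) \<Rightarrow> ('h \<Rightarrow> 'h)" where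
  "module_adjoint ip T = (THE T'. is_module_adjoint ip T T')"


section \<open>The Bochner integral without separability\<close>

text \<open>The library's \<open>has_bochner_integral\<close> needs a second countable codomain, which would restrict
  the theory to separable C*-algebras. The following is the usual definition for an arbitrary
  Banach space, with strong measurability in place of Borel measurability; on second countable
  spaces it extends the library notion (lemma \<open>has_bint_iff_has_bochner_integral\<close>).\<close>

definition strongly_measurable :: "'w measure \<Rightarrow> ('w \<Rightarrow> 'b::real_normed_vector) \<Rightarrow> bool" where
  "strongly_measurable M f \<longleftrightarrow>
     (\<exists>s. (\<forall>i::nat. simple_function M (s i)) \<and> (AE w in M. (\<lambda>i. s i w) \<longlonglongrightarrow> f w))"

definition has_bint :: "'w measure \<Rightarrow> ('w \<Rightarrow> 'b::real_normed_vector) \<Rightarrow> 'b \<Rightarrow> bool" where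
  "has_bint M f I \<longleftrightarrow> strongly_measurable M f \<and>
     (\<exists>s. (\<forall>i::nat. Bochner_Integration.simple_bochner_integrable M (s i)) \<and>
        (\<lambda>i. \<integral>\<^sup>+ w. ennreal (norm (f w - s i w)) \<partial>M) \<longlonglongrightarrow> 0 \<and>
        (\<lambda>i. Bochner_Integration.simple_bochner_integral M (s i)) \<longlonglongrightarrow> I)"

definition bintegrable :: "'w measure \<Rightarrow> ('w \<Rightarrow> 'b::real_normed_vector) \<Rightarrow> bool" where
  "bintegrable M f \<longleftrightarrow> (\<exists>I. has_bint M f I)"

definition bint :: "'w measure \<Rightarrow> ('w \<Rightarrow> 'b::real_normed_vector) \<Rightarrow> 'b" where
  "bint M f = (THE I. has_bint M f I)"

lemma has_bint_iff_has_bochner_integral: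
  fixes f :: "'w \<Rightarrow> 'b::{banach, second_countable_topology}"
  assumes f: "f \<in> borel_measurable M"
  shows "has_bint M f I \<longleftrightarrow> has_bochner_integral M f I"
proof -
  obtain s where "\<And>i. simple_function M (s i)"
      and "\<And>x. x \<in> space M \<Longrightarrow> (\<lambda>i. s i x) \<longlonglongrightarrow> f x"
    using borel_measurable_implies_sequence_metric[OF f, of 0] by metis
  then have "strongly_measurable M f"
    unfolding strongly_measurable_def by (intro exI[of _ s]) auto
  then show ?thesis
    using f by (auto simp: has_bint_def has_bochner_integral.simps)
qed


section \<open>The space of square-integrable families\<close>

text \<open>Elements are represented by functions; identification of families that agree almost
  everywhere is expressed by stating equations between them almost everywhere.\<close>

definition l2_ip :: "'w measure \<Rightarrow> ('h \<Rightarrow> 'h \<Rightarrow> 'a::unital_cstar_algebra) \<Rightarrow>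
    ('w \<Rightarrow> 'h) \<Rightarrow> ('w \<Rightarrow> 'h) \<Rightarrow> 'a" where
  "l2_ip M ip f g = bint M (\<lambda>w. ip (f w) (g w))"

definition l2_space :: "'w measure \<Rightarrow> ('h::complex_normed_space \<Rightarrow> 'h \<Rightarrow> 'a::unital_cstar_algebra) \<Rightarrow>
    ('w \<Rightarrow> 'h) set" where
  "l2_space M ip = {f. strongly_measurable M f \<and> bintegrable M (\<lambda>w. ip (f w) (f w))}"

definition l2_norm :: "'w measure \<Rightarrow> ('h \<Rightarrow> 'h \<Rightarrow> 'a::unital_cstar_algebra) \<Rightarrow> ('w \<Rightarrow> 'h) \<Rightarrow> real" where
  "l2_norm M ip f = sqrt (norm (l2_ip M ip f f))"

text \<open>An operator on equivalence classes is represented by an operator on functions that respects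
  equality almost everywhere. Linearity is over the complex numbers.\<close>

definition l2_bounded_linear ::
  "'w measure \<Rightarrow> ('h::complex_normed_space \<Rightarrow> 'h \<Rightarrow> 'a::unital_cstar_algebra) \<Rightarrow>
    (('w \<Rightarrow> 'h) \<Rightarrow> ('w \<Rightarrow> 'h)) \<Rightarrow> bool" where
  "l2_bounded_linear M ip S \<longleftrightarrow>
     (\<forall>f\<in>l2_space M ip. S f \<in> l2_space M ip) \<and>
     (\<forall>f\<in>l2_space M ip. \<forall>g\<in>l2_space M ip.
        (AE w in M. f w = g w) \<longrightarrow> (AE w in M. S f w = S g w)) \<and>
     (\<forall>f\<in>l2_space M ip. \<forall>g\<in>l2_space M ip.
        AE w in M. S (\<lambda>v. f v + g v) w = S f w + S g w) \<and>
     (\<forall>c. \<forall>f\<in>l2_space M ip. AE w in M. S (\<lambda>v. c *\<^sub>C f v) w = c *\<^sub>C S f w) \<and>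
     (\<exists>C. \<forall>f\<in>l2_space M ip. l2_norm M ip (S f) \<le> C * l2_norm M ip f)"


section \<open>Continuous K-operator frames\<close>

definition operator_family :: "'w measure \<Rightarrow> ('h::complex_normed_space \<Rightarrow> 'h \<Rightarrow> 'a) \<Rightarrow>
    ('w \<Rightarrow> 'h \<Rightarrow> 'h) \<Rightarrow> bool" where
  "operator_family M ip T \<longleftrightarrow>
     (\<forall>w\<in>space M. T w \<in> adjointables ip) \<and> (\<forall>x. strongly_measurable M (\<lambda>w. T w x))"

definition K_operator_frame_bounds ::
  "'w measure \<Rightarrow> ('h::complex_normed_space \<Rightarrow> 'h \<Rightarrow> 'a::unital_cstar_algebra) \<Rightarrow> ('h \<Rightarrow> 'h) \<Rightarrow>
    ('w \<Rightarrow> 'h \<Rightarrow> 'h) \<Rightarrow> real \<Rightarrow> real \<Rightarrow> bool" where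
  "K_operator_frame_bounds M ip K T A B \<longleftrightarrow>
     operator_family M ip T \<and> A > 0 \<and> B > 0 \<and>
     (\<forall>x. bintegrable M (\<lambda>w. ip (T w x) (T w x)) \<and>
        A *\<^sub>R ip (module_adjoint ip K x) (module_adjoint ip K x)
          \<le>\<^sub>A bint M (\<lambda>w. ip (T w x) (T w x)) \<and>
        bint M (\<lambda>w. ip (T w x) (T w x)) \<le>\<^sub>A B *\<^sub>R ip x x)"

definition continuous_K_operator_frame ::
  "'w measure \<Rightarrow> ('h::complex_normed_space \<Rightarrow> 'h \<Rightarrow> 'a::unital_cstar_algebra) \<Rightarrow> ('h \<Rightarrow> 'h) \<Rightarrow>
    ('w \<Rightarrow> 'h \<Rightarrow> 'h) \<Rightarrow> bool" where
  "continuous_K_operator_frame M ip K T \<longleftrightarrow> (\<exists>A B. K_operator_frame_bounds M ip K T A B)"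

end

theory Submission
  imports Defs
begin

text \<open>Write \<open>F\<^sub>w = \<Sum>\<^sub>k R\<^sub>k\<^sub>,\<^sub>w\<close> and, for a square-integrable family \<open>f\<close>, \<open>gram f = \<integral>\<langle>f\<^sub>w, f\<^sub>w\<rangle>\<close>.
  Bounds in norm are easy. The splitting \<open>R\<^sub>k = T\<^sub>k - (T\<^sub>k - R\<^sub>k)\<close> and the hypothesis on \<open>\<lambda>\<close>
  make every \<open>R\<^sub>k\<close>, hence \<open>F\<close>, bounded as a map into the square-integrable families:
  \<open>\<parallel>gram (F x)\<parallel> \<le> d \<parallel>x\<parallel>\<^sup>2\<close>. In the other direction, the lower frame bound of \<open>T\<^sub>p\<close> and
  the boundedness of \<open>S\<close> give
  \<open>A\<^sub>p \<parallel>K\<^sup>*x\<parallel>\<^sup>2 \<le> \<parallel>gram (T\<^sub>p x)\<parallel> = \<parallel>gram (S (F x))\<parallel> \<le> C\<^sup>2 \<parallel>gram (F x)\<parallel>\<close>.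

  A frame, however, needs inequalities in the order of the algebra. They follow because all maps
  involved are linear over the algebra: the quantities compared, say \<open>u x\<close> and \<open>v x\<close>, are
  positive and satisfy \<open>u (a x) = a (u x) a\<^sup>*\<close>. If \<open>\<parallel>u x\<parallel> \<le> c \<parallel>v x\<parallel>\<close> for all \<open>x\<close>, apply this
  to \<open>h x\<close> with \<open>h = (v x + \<epsilon>)\<^sup>-\<^sup>1\<^sup>/\<^sup>2\<close>. Then \<open>h (v x) h \<le> 1\<close>, so the positive element \<open>h (u x) h\<close>
  has norm at most \<open>c\<close> and is therefore at most \<open>c\<close>; conjugating by the inverse of \<open>h\<close> gives
  \<open>u x \<le> c (v x + \<epsilon>)\<close>, and \<open>\<epsilon>\<close> tends to \<open>0\<close> (lemma
  \<open>comparison_of_quadratic_maps\<close>).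

  Two bodies of theory support the argument. The first is the order of a C*-algebra with
  positivity defined by the spectrum: the norm of a selfadjoint element is its spectral radius,
  so positivity of a selfadjoint \<open>a\<close> amounts to \<open>\<parallel>t - a\<parallel> \<le> t\<close> for some \<open>t\<close>, from which the positive
  elements are seen to form a closed convex cone; inverse square roots come from the binomial series.
  The second is the Bochner integral with values in an arbitrary Banach space, up to the
  criterion that a strongly measurable function with integrable norm is integrable and the
  fact that integrals of positive functions are positive.\<close>

section \<open>Scalars, star and norm\<close>

lemma bounded_bilinear_scaleC:
  "bounded_bilinear (scaleC :: complex \<Rightarrow> 'a::complex_normed_space \<Rightarrow> 'a)"
proof
  fix r :: real and c d :: complex and x y :: 'a
  show "(c + d) *\<^sub>C x = c *\<^sub>C x + d *\<^sub>C x" "c *\<^sub>C (x + y) = c *\<^sub>C x + c *\<^sub>C y"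
    by (fact scaleC_add_left scaleC_add_right)+
  show "(r *\<^sub>R c) *\<^sub>C x = r *\<^sub>R c *\<^sub>C x"
    by (simp add: scaleC_of_real[symmetric] scaleC_scaleC scaleR_conv_of_real)
  show "c *\<^sub>C r *\<^sub>R x = r *\<^sub>R c *\<^sub>C x"
    by (simp add: scaleC_of_real[symmetric] scaleC_scaleC mult.commute)
  show "\<exists>K. \<forall>a b. norm (a *\<^sub>C (b::'a)) \<le> norm a * norm b * K"
    by (rule exI[of _ 1]) (simp add: norm_scaleC)
qed

lemmas scaleC_zero_left [simp] = bounded_bilinear.zero_left[OF bounded_bilinear_scaleC]
  and scaleC_minus_left = bounded_bilinear.minus_left[OF bounded_bilinear_scaleC]
  and scaleC_diff_left = bounded_bilinear.diff_left[OF bounded_bilinear_scaleC]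
  and scaleC_diff_right = bounded_bilinear.diff_right[OF bounded_bilinear_scaleC]

lemma scaleC_one [simp]: "(1::complex) *\<^sub>C (x::'a::complex_normed_space) = x"
  using scaleC_of_real[of 1 x] by simp

lemma star_scaleR: "star (r *\<^sub>R a) = r *\<^sub>R star (a::'a::unital_cstar_algebra)"
  using star_scaleC[of "of_real r" a] by (simp add: scaleC_of_real)

lemma star_one [simp]: "star (1::'a::unital_cstar_algebra) = 1"
  using star_mult[of "star 1" "1::'a"] by (simp add: star_star)

lemma norm_star [simp]: "norm (star a) = norm (a::'a::unital_cstar_algebra)"
proof -
  have "norm b \<le> norm (star b)" for b :: 'a
  proof (cases "b = 0")
    case False
    have "norm b * norm b \<le> norm (star b) * norm b"
      using cstar_identity[of b] norm_mult_ineq[of "star b" b] by (simp add: power2_eq_square)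
    with False show ?thesis by simp
  qed simp
  from this[of a] this[of "star a"] show ?thesis
    by (simp add: star_star)
qed

lemma bounded_linear_star: "bounded_linear (star :: 'a::unital_cstar_algebra \<Rightarrow> 'a)"
  by (rule bounded_linear_intro[where K = 1]) (simp_all add: star_add star_scaleR)

lemmas star_diff = linear_diff[OF bounded_linear.linear[OF bounded_linear_star]]

text \<open>Equality fails in the zero algebra, where \<open>\<parallel>1\<parallel> = 0\<close>.\<close>

lemma norm_one_le: "norm (1::'a::unital_cstar_algebra) \<le> 1"
  using cstar_identity[of "1::'a"]
  by (metis mult.right_neutral norm_eq_zero order.refl power2_eq_square star_one mult_cancel_left
      zero_less_one_class.zero_le_one)

lemma norm_power_le: "norm (a ^ n) \<le> norm (a::'a::unital_cstar_algebra) ^ n"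
proof (induction n)
  case 0
  show ?case using norm_one_le by simp
next
  case (Suc n)
  have "norm (a ^ Suc n) \<le> norm a * norm (a ^ n)"
    using norm_mult_ineq by simp
  also have "\<dots> \<le> norm a * norm a ^ n"
    using Suc by (simp add: mult_left_mono)
  finally show ?case by simp
qed

section \<open>Inverses and the Neumann series\<close>

definition two_sided_inverse :: "'a::monoid_mult \<Rightarrow> 'a \<Rightarrow> bool" where
  "two_sided_inverse a b \<longleftrightarrow> b * a = 1 \<and> a * b = 1"

definition has_inverse :: "'a::monoid_mult \<Rightarrow> bool" where
  "has_inverse a \<longleftrightarrow> (\<exists>b. two_sided_inverse a b)"

lemma cstar_spectrum_iff: "z \<in> cstar_spectrum a \<longleftrightarrow> \<not> has_inverse (a - z *\<^sub>C 1)"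
  by (simp add: cstar_spectrum_def has_inverse_def two_sided_inverse_def)

lemma two_sided_inverse_unique:
  "two_sided_inverse a b \<Longrightarrow> two_sided_inverse a c \<Longrightarrow> b = c"
  unfolding two_sided_inverse_def by (metis mult.assoc mult_1_left mult_1_right)

lemma two_sided_inverse_mult:
  assumes "two_sided_inverse a b" "two_sided_inverse c d"
  shows "two_sided_inverse (a * c) (d * b)"
proof -
  have "d * b * (a * c) = d * (b * a) * c" "a * c * (d * b) = a * (c * d) * b"
    by (simp_all add: mult.assoc)
  with assms show ?thesis
    by (simp add: two_sided_inverse_def)
qed

lemma has_inverse_mult: "has_inverse a \<Longrightarrow> has_inverse b \<Longrightarrow> has_inverse (a * b)"
  unfolding has_inverse_def using two_sided_inverse_mult by blast

lemma two_sided_inverse_scaleC: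
  assumes "two_sided_inverse a b" "z \<noteq> 0"
  shows "two_sided_inverse (z *\<^sub>C a) (inverse z *\<^sub>C (b::'a::unital_cstar_algebra))"
  using assms
  by (simp add: two_sided_inverse_def mult_scaleC_left mult_scaleC_right scaleC_scaleC)

lemma has_inverse_scaleC_iff:
  assumes "z \<noteq> 0"
  shows "has_inverse (z *\<^sub>C a) \<longleftrightarrow> has_inverse (a::'a::unital_cstar_algebra)"
proof
  assume "has_inverse (z *\<^sub>C a)"
  then obtain b where "two_sided_inverse (z *\<^sub>C a) b" by (auto simp: has_inverse_def)
  from two_sided_inverse_scaleC[OF this, of "inverse z"] assms show "has_inverse a"
    by (auto simp: has_inverse_def scaleC_scaleC)
next
  assume "has_inverse a"
  with two_sided_inverse_scaleC[OF _ assms] show "has_inverse (z *\<^sub>C a)"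
    by (auto simp: has_inverse_def)
qed

lemma has_inverse_minus_iff:
  "has_inverse (- a) \<longleftrightarrow> has_inverse (a::'a::unital_cstar_algebra)"
  using has_inverse_scaleC_iff[of "-1" a] by (simp add: scaleC_minus_left)

lemma two_sided_inverse_star:
  "two_sided_inverse a b \<Longrightarrow> two_sided_inverse (star a) (star (b::'a::unital_cstar_algebra))"
  unfolding two_sided_inverse_def by (metis star_mult star_one)

lemma summable_norm_power:
  assumes "norm (a::'a::unital_cstar_algebra) < 1"
  shows "summable (\<lambda>n. norm (a ^ n))"
  using summable_comparison_test'[OF summable_geometric[of "norm a"], of 0 "\<lambda>n. norm (a ^ n)"]
    assms norm_power_le by auto

lemma neumann_series:
  assumes "norm (a::'a::unital_cstar_algebra) < 1"
  shows "two_sided_inverse (1 - a) (\<Sum>n. a ^ n)"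
proof -
  have s: "summable (\<lambda>n. a ^ n)"
    using summable_norm_cancel[OF summable_norm_power[OF assms]] .
  have *: "(\<Sum>n. a ^ n) = 1 + (\<Sum>n. a ^ Suc n)"
    using suminf_split_head[OF s] by (simp add: algebra_simps)
  have "(\<Sum>n. a ^ Suc n) = a * (\<Sum>n. a ^ n)" "(\<Sum>n. a ^ Suc n) = (\<Sum>n. a ^ n) * a"
    using suminf_mult[OF s, of a] suminf_mult2[OF s, of a]
    by (simp_all add: power_commutes)
  with * show ?thesis
    unfolding two_sided_inverse_def by (simp add: left_diff_distrib right_diff_distrib algebra_simps)
qed

lemma spectrum_bound:
  assumes "z \<in> cstar_spectrum (a::'a::unital_cstar_algebra)"
  shows "cmod z \<le> norm a"
proof (rule ccontr)
  assume "\<not> cmod z \<le> norm a"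
  then have z: "norm a < cmod z" "z \<noteq> 0" by auto
  then have "norm (inverse z *\<^sub>C a) < 1"
    unfolding norm_scaleC norm_inverse by (simp add: field_simps)
  then have "has_inverse (1 - inverse z *\<^sub>C a)"
    using neumann_series has_inverse_def by blast
  then have "has_inverse (- z *\<^sub>C (1 - inverse z *\<^sub>C a))"
    using has_inverse_scaleC_iff[of "- z" "1 - inverse z *\<^sub>C a"] z by simp
  also have "- z *\<^sub>C (1 - inverse z *\<^sub>C a) = a - z *\<^sub>C 1"
    using z by (simp add: scaleC_diff_right scaleC_scaleC scaleC_minus_left)
  finally show False
    using assms by (simp add: cstar_spectrum_iff)
qed

text \<open>For selfadjoint \<open>a\<close> and real \<open>t\<close>, the C*-identity gives \<open>\<parallel>a + it\<parallel>\<^sup>2 \<le> \<parallel>a\<parallel>\<^sup>2 + t\<^sup>2\<close>. If \<open>x + iy\<close>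
  lies in the spectrum of \<open>a\<close>, then \<open>x + i(y + t)\<close> lies in that of \<open>a + it\<close>, whence
  \<open>x\<^sup>2 + y\<^sup>2 + 2 t y \<le> \<parallel>a\<parallel>\<^sup>2\<close> for every real \<open>t\<close>, which forces \<open>y = 0\<close>.\<close>

lemma selfadjoint_spectrum_real:
  assumes sa: "star a = a" and z: "z \<in> cstar_spectrum (a::'a::unital_cstar_algebra)"
  shows "Im z = 0"
proof (rule ccontr)
  assume ne: "Im z \<noteq> 0"
  have *: "(Re z)\<^sup>2 + (Im z)\<^sup>2 + 2 * t * Im z \<le> (norm a)\<^sup>2" for t :: real
  proof -
    define i where "i = Complex 0 t"
    let ?b = "a + i *\<^sub>C 1"
    have "z + i \<in> cstar_spectrum ?b"
      using z by (simp add: cstar_spectrum_iff scaleC_add_left)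
    then have "(cmod (z + i))\<^sup>2 \<le> (norm ?b)\<^sup>2"
      by (intro power_mono spectrum_bound) auto
    also have "(norm ?b)\<^sup>2 = norm ((a - i *\<^sub>C 1) * ?b)"
    proof -
      have "cnj i = - i" by (simp add: i_def complex_eq_iff)
      then have "star ?b = a - i *\<^sub>C 1"
        by (simp add: star_add star_scaleC sa scaleC_minus_left)
      then show ?thesis
        by (metis cstar_identity)
    qed
    also have "(a - i *\<^sub>C 1) * ?b = a * a + t\<^sup>2 *\<^sub>R 1"
    proof -
      have "i * i = - of_real (t\<^sup>2)"
        by (simp add: i_def complex_eq_iff power2_eq_square)
      then have "i *\<^sub>C i *\<^sub>C (1::'a) = - (t\<^sup>2 *\<^sub>R 1)"
        by (simp only: scaleC_scaleC scaleC_minus_left scaleC_of_real)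
      then show ?thesis
        by (simp add: left_diff_distrib distrib_left mult_scaleC_left mult_scaleC_right
            scaleC_diff_right scaleC_add_right)
    qed
    also have "norm (a * a + t\<^sup>2 *\<^sub>R 1) \<le> (norm a)\<^sup>2 + t\<^sup>2"
    proof -
      have "norm (a * a) \<le> (norm a)\<^sup>2"
        using norm_mult_ineq by (simp add: power2_eq_square)
      moreover have "norm (t\<^sup>2 *\<^sub>R (1::'a)) \<le> t\<^sup>2"
        using norm_one_le mult_left_mono[of "norm (1::'a)" 1 "t\<^sup>2"] by simp
      ultimately show ?thesis
        using norm_triangle_ineq[of "a * a" "t\<^sup>2 *\<^sub>R (1::'a)"] by linarith
    qed
    finally have "(cmod (z + i))\<^sup>2 \<le> (norm a)\<^sup>2 + t\<^sup>2" .
    then show ?thesis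
      unfolding cmod_power2 by (simp add: i_def power2_eq_square algebra_simps)
  qed
  have "(Re z)\<^sup>2 + (Im z)\<^sup>2 + ((norm a)\<^sup>2 + 1) \<le> (norm a)\<^sup>2"
  proof -
    have "2 * (((norm a)\<^sup>2 + 1) / (2 * Im z)) * Im z = (norm a)\<^sup>2 + 1"
      using ne by simp
    with *[of "((norm a)\<^sup>2 + 1) / (2 * Im z)"] show ?thesis by linarith
  qed
  moreover have "0 \<le> (Re z)\<^sup>2 + (Im z)\<^sup>2" by simp
  ultimately show False by linarith
qed

section \<open>The norm of a selfadjoint element is its spectral radius\<close>

text \<open>The partial fraction identity \<open>2 (1 - w\<^sup>2c\<^sup>2)\<^sup>-\<^sup>1 = (1 - w c)\<^sup>-\<^sup>1 + (1 + w c)\<^sup>-\<^sup>1\<close>. It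
  expresses the resolvent of \<open>c\<^sup>2\<close> as an average of two resolvents of \<open>c\<close>; iterating it replaces the
  usual average over all roots of unity of order \<open>2\<^sup>m\<close>.\<close>

lemma resolvent_square:
  fixes c :: "'a::unital_cstar_algebra"
  assumes p: "two_sided_inverse (1 - w *\<^sub>C c) p" and q: "two_sided_inverse (1 - (- w) *\<^sub>C c) q"
  shows "two_sided_inverse (1 - (w * w) *\<^sub>C (c * c)) ((1/2) *\<^sub>R (p + q))"
proof -
  let ?d = "w *\<^sub>C c"
  have e: "1 - (w * w) *\<^sub>C (c * c) = (1 - ?d) * (1 + ?d)"
    "1 - (w * w) *\<^sub>C (c * c) = (1 + ?d) * (1 - ?d)"
    by (simp_all add: algebra_simps mult_scaleC_left mult_scaleC_right scaleC_scaleC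
        scaleC_add_right scaleC_diff_right)
  have pq: "p * (1 - ?d) = 1" "(1 - ?d) * p = 1" "q * (1 + ?d) = 1" "(1 + ?d) * q = 1"
    using p q by (simp_all add: two_sided_inverse_def scaleC_minus_left)
  have s: "(1 + ?d) + (1 - ?d) = 2 *\<^sub>R (1::'a)"
    by (simp add: scaleR_2)
  have "(p + q) * (1 - (w * w) *\<^sub>C (c * c)) = p * ((1 - ?d) * (1 + ?d)) + q * ((1 + ?d) * (1 - ?d))"
    using e by (metis distrib_right)
  also have "\<dots> = (1 + ?d) + (1 - ?d)"
    using pq by (simp flip: mult.assoc)
  finally have 1: "(p + q) * (1 - (w * w) *\<^sub>C (c * c)) = 2 *\<^sub>R 1" using s by simp
  have "(1 - (w * w) *\<^sub>C (c * c)) * (p + q) = ((1 + ?d) * (1 - ?d)) * p + ((1 - ?d) * (1 + ?d)) * q"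
    using e by (metis distrib_left)
  also have "\<dots> = (1 + ?d) + (1 - ?d)"
    using pq by (simp add: mult.assoc)
  finally have 2: "(1 - (w * w) *\<^sub>C (c * c)) * (p + q) = 2 *\<^sub>R 1" using s by simp
  show ?thesis
    unfolding two_sided_inverse_def using 1 2 by simp
qed

text \<open>The point of measuring the distance of resolvents on the unit circle only is that this distance does
  not grow when both elements are squared.\<close>

definition resolvents_close :: "real \<Rightarrow> 'a::unital_cstar_algebra \<Rightarrow> 'a \<Rightarrow> bool" where
  "resolvents_close e a b \<longleftrightarrow> (\<forall>z. cmod z = 1 \<longrightarrow>
     (\<exists>p q. two_sided_inverse (1 - z *\<^sub>C a) p \<and> two_sided_inverse (1 - z *\<^sub>C b) q \<and> norm (p - q) \<le> e))"

lemma resolvents_close_square: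
  assumes "resolvents_close e a b"
  shows "resolvents_close e (a * a) (b * b)"
  unfolding resolvents_close_def
proof (intro allI impI)
  fix z :: complex assume z: "cmod z = 1"
  define w where "w = csqrt z"
  have w: "w * w = z" "cmod w = 1" "cmod (- w) = 1"
    using z power2_csqrt[of z] by (simp_all add: w_def power2_eq_square)
  obtain p q where pq: "two_sided_inverse (1 - w *\<^sub>C a) p" "two_sided_inverse (1 - w *\<^sub>C b) q"
      "norm (p - q) \<le> e"
    using assms w unfolding resolvents_close_def by blast
  obtain p' q' where pq': "two_sided_inverse (1 - (- w) *\<^sub>C a) p'"
      "two_sided_inverse (1 - (- w) *\<^sub>C b) q'" "norm (p' - q') \<le> e"
    using assms w unfolding resolvents_close_def by blast
  have "norm ((1/2) *\<^sub>R (p + p') - (1/2) *\<^sub>R (q + q')) = norm ((p - q) + (p' - q')) / 2"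
    unfolding scaleR_diff_right[symmetric] norm_scaleR by (simp add: algebra_simps)
  also have "\<dots> \<le> e"
    using norm_triangle_ineq[of "p - q" "p' - q'"] pq(3) pq'(3) by simp
  finally show "\<exists>p q. two_sided_inverse (1 - z *\<^sub>C (a * a)) p \<and> two_sided_inverse (1 - z *\<^sub>C (b * b)) q
      \<and> norm (p - q) \<le> e"
    using resolvent_square[OF pq(1) pq'(1)] resolvent_square[OF pq(2) pq'(2)] w(1) by auto
qed

lemma resolvents_close_power:
  "resolvents_close e a b \<Longrightarrow> resolvents_close e (a ^ 2 ^ m) (b ^ 2 ^ m)"
proof (induction m)
  case (Suc m)
  from resolvents_close_square[OF this(1)[OF this(2)]] show ?case
    by (simp add: mult_2 power_add)
qed simp

lemma norm_selfadjoint_power: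
  assumes "star a = a"
  shows "norm ((a::'a::unital_cstar_algebra) ^ 2 ^ m) = norm a ^ 2 ^ m"
proof -
  have sa: "star (a ^ k) = a ^ k" for k
    by (induction k) (simp_all add: star_mult assms power_commutes)
  show ?thesis
  proof (induction m)
    case (Suc m)
    have "norm (a ^ 2 ^ Suc m) = norm (star (a ^ 2 ^ m) * a ^ 2 ^ m)"
      by (simp add: sa mult_2 power_add)
    with Suc show ?case
      by (simp add: cstar_identity mult_2 power_add power2_eq_square)
  qed simp
qed

text \<open>The resolvent identity \<open>q v - q z = (v - z) (q v) a (q z)\<close> first shows that \<open>q\<close> is bounded
  near \<open>z\<close>, and then that it is continuous at \<open>z\<close>.\<close>

lemma continuous_on_resolvent:
  fixes a :: "'a::unital_cstar_algebra"
  assumes q: "\<And>z. z \<in> D \<Longrightarrow> two_sided_inverse (1 - z *\<^sub>C a) (q z)"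
  shows "continuous_on D q"
  unfolding continuous_on_def
proof
  fix z assume z: "z \<in> D"
  define C where "C = 1 + norm a * norm (q z)"
  have C: "C > 0" by (simp add: C_def add_pos_nonneg)
  have identity: "q v - q z = (v - z) *\<^sub>C (q v * a * q z)" if v: "v \<in> D" for v
  proof -
    have "q v - q z = q v * ((1 - z *\<^sub>C a) * q z) - (q v * (1 - v *\<^sub>C a)) * q z"
      using q[OF v] q[OF z] by (simp add: two_sided_inverse_def)
    also have "\<dots> = q v * ((1 - z *\<^sub>C a) - (1 - v *\<^sub>C a)) * q z"
      by (simp add: algebra_simps)
    also have "(1 - z *\<^sub>C a) - (1 - v *\<^sub>C a) = (v - z) *\<^sub>C a"
      by (simp add: scaleC_diff_left)
    finally show ?thesis
      by (simp add: mult_scaleC_left mult_scaleC_right)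
  qed
  have bound: "norm (q v - q z) \<le> 2 * C * norm (q z) * cmod (v - z)"
    if v: "v \<in> D" "cmod (v - z) \<le> 1 / (2 * C)" for v
  proof -
    have "norm (q v * a * q z) \<le> norm (q v) * norm a * norm (q z)"
      by (meson mult_right_mono norm_ge_zero norm_mult_ineq order_trans)
    also have "\<dots> \<le> norm (q v) * C"
      by (simp add: C_def mult.assoc mult_left_mono)
    finally have 1: "norm (q v - q z) \<le> cmod (v - z) * (norm (q v) * C)"
      by (simp add: identity[OF v(1)] norm_scaleC mult_left_mono)
    also have "\<dots> = (cmod (v - z) * C) * norm (q v)" by simp
    also have "\<dots> \<le> 1/2 * norm (q v)"
      using v(2) C by (intro mult_right_mono) (simp_all add: field_simps)
    finally have "norm (q v) \<le> 2 * norm (q z)"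
      using norm_triangle_ineq2[of "q v" "q z"] by simp
    then have "cmod (v - z) * (norm (q v) * C) \<le> cmod (v - z) * (2 * norm (q z) * C)"
      using C by (intro mult_left_mono mult_right_mono) auto
    with 1 show ?thesis by (simp add: mult_ac)
  qed
  show "(q \<longlongrightarrow> q z) (at z within D)"
  proof (rule Lim_null_comparison[THEN Lim_null[THEN iffD2]])
    show "\<forall>\<^sub>F v in at z within D. norm (q v - q z) \<le> 2 * C * norm (q z) * cmod (v - z)"
      unfolding eventually_at using C bound
      by (intro exI[of _ "1 / (2 * C)"]) (auto simp: dist_norm)
    have "((\<lambda>v. 2 * C * norm (q z) * cmod (v - z)) \<longlongrightarrow> 2 * C * norm (q z) * cmod (z - z)) (at z within D)"
      by (intro tendsto_intros)
    then show "((\<lambda>v. 2 * C * norm (q z) * cmod (v - z)) \<longlongrightarrow> 0) (at z within D)" by simp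
  qed
qed

text \<open>The spectral radius of a selfadjoint element of norm one is one. If the resolvent existed on the
  whole closed disc, it would be uniformly continuous there, so for some \<open>s < 1\<close> the
  resolvents of \<open>s a\<close> and \<open>a\<close> would be uniformly close on the circle, and hence also those of
  \<open>(s a)\<^sup>N\<close> and \<open>a\<^sup>N\<close> for \<open>N = 2\<^sup>k\<close>. But \<open>(s a)\<^sup>N\<close> tends to \<open>0\<close>, so \<open>(1 - a\<^sup>N)\<^sup>-\<^sup>1\<close> would be close
  to \<open>1\<close>, which contradicts \<open>\<parallel>a\<^sup>N\<parallel> = 1\<close>.\<close>

lemma selfadjoint_resolvent_singular:
  fixes a :: "'a::unital_cstar_algebra"
  assumes sa: "star a = a" and n1: "norm a = 1"
  obtains z where "cmod z \<le> 1" "\<not> has_inverse (1 - z *\<^sub>C a)"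
proof (rule ccontr)
  assume "\<not> thesis"
  with that have "\<forall>z\<in>cball 0 1. \<exists>b. two_sided_inverse (1 - z *\<^sub>C a) b"
    unfolding has_inverse_def by force
  then obtain q where q: "\<And>z. z \<in> cball 0 1 \<Longrightarrow> two_sided_inverse (1 - z *\<^sub>C a) (q z)"
    by (metis (no_types))
  have "uniformly_continuous_on (cball 0 1) q"
    by (intro compact_uniformly_continuous continuous_on_resolvent[of _ a] q) auto
  then obtain d where d: "d > 0"
      "\<And>v z. v \<in> cball 0 1 \<Longrightarrow> z \<in> cball 0 1 \<Longrightarrow> dist v z < d \<Longrightarrow> dist (q v) (q z) < 1/8"
    unfolding uniformly_continuous_on_def by (metis zero_less_divide_1_iff zero_less_numeral)
  define s where "s = max (1/2) (1 - d/2)"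
  have s: "0 < s" "s < 1" "1 - s < d" using d(1) by (auto simp: s_def)
  have close: "resolvents_close (1/8) (s *\<^sub>R a) a"
    unfolding resolvents_close_def
  proof (intro allI impI)
    fix z :: complex assume z: "cmod z = 1"
    have zs: "of_real s * z \<in> cball 0 1" "z \<in> cball 0 1"
      using s z by (simp_all add: norm_mult)
    have "of_real s * z - z = of_real (s - 1) * z" by (simp add: algebra_simps)
    then have "dist (of_real s * z) z = 1 - s"
      using z s by (simp add: dist_norm norm_mult del: of_real_diff)
    with d(2)[OF zs] s have "norm (q (of_real s * z) - q z) \<le> 1/8"
      by (simp add: dist_norm)
    moreover have "z *\<^sub>C (s *\<^sub>R a) = (of_real s * z) *\<^sub>C a"
      by (simp add: scaleC_of_real[symmetric] scaleC_scaleC mult.commute)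
    ultimately show "\<exists>p q. two_sided_inverse (1 - z *\<^sub>C (s *\<^sub>R a)) p \<and>
        two_sided_inverse (1 - z *\<^sub>C a) q \<and> norm (p - q) \<le> 1/8"
      using q[OF zs(1)] q[OF zs(2)] by auto
  qed
  obtain k where k: "s ^ k < 1/16"
    using real_arch_pow_inv[of "1/16" s] s by auto
  \<comment> \<open>\<open>N\<close> has to be a power of two, both for the squaring argument and for \<open>\<parallel>a\<^sup>N\<parallel> = 1\<close>.\<close>
  define N :: nat where "N = 2 ^ k"
  have "k \<le> N" by (simp add: N_def less_imp_le)
  then have sN: "s ^ N < 1/16"
    using order.strict_trans1[OF power_decreasing[of k N s] k] s by simp
  have nb: "norm ((s *\<^sub>R a) ^ N) < 1/16"
    using norm_power_le[of "s *\<^sub>R a" N] n1 s sN by simp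
  have na: "norm (a ^ N) = 1"
    unfolding N_def by (simp add: norm_selfadjoint_power[OF sa] n1)
  from resolvents_close_power[OF close, of k, folded N_def]
  obtain p r where pr: "two_sided_inverse (1 - (s *\<^sub>R a) ^ N) p" "two_sided_inverse (1 - a ^ N) r"
      "norm (p - r) \<le> 1/8"
    unfolding resolvents_close_def by (metis norm_one scaleC_one)
  let ?b = "(s *\<^sub>R a) ^ N"
  have "p - 1 = p * ?b"
    using pr(1) by (simp add: two_sided_inverse_def algebra_simps)
  then have "p - 1 = ?b + (p - 1) * ?b" by (simp add: algebra_simps)
  then have "norm (p - 1) \<le> norm ?b + norm (p - 1) * norm ?b"
    using norm_triangle_ineq[of ?b "(p - 1) * ?b"] norm_mult_ineq[of "p - 1" ?b]
    by simp
  also have "\<dots> \<le> 1/16 + norm (p - 1) * (1/16)"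
    using nb by (intro add_mono mult_left_mono) auto
  finally have "norm (p - 1) \<le> 1/8" by simp
  with pr(3) have r1: "norm (r - 1) \<le> 1/4"
    using norm_triangle_ineq4[of "p - 1" "p - r"] by simp
  have "r - 1 = r * a ^ N"
    using pr(2) by (simp add: two_sided_inverse_def algebra_simps)
  then have "a ^ N = (r - 1) - (r - 1) * a ^ N" by (simp add: algebra_simps)
  then have "norm (a ^ N) \<le> norm (r - 1) + norm (r - 1) * norm (a ^ N)"
    using norm_triangle_ineq4[of "r - 1" "(r - 1) * a ^ N"] norm_mult_ineq[of "r - 1" "a ^ N"]
    by simp
  with na r1 show False by simp
qed

lemma selfadjoint_norm_le:
  fixes a :: "'a::unital_cstar_algebra"
  assumes sa: "star a = a" and r: "0 \<le> r" "\<And>z. z \<in> cstar_spectrum a \<Longrightarrow> cmod z \<le> r"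
  shows "norm a \<le> r"
proof (rule ccontr)
  assume "\<not> norm a \<le> r"
  then have na: "norm a > r" "norm a > 0" using r(1) by auto
  define b where "b = inverse (norm a) *\<^sub>R a"
  have "star b = b" "norm b = 1"
    using na by (auto simp: b_def star_scaleR sa)
  then obtain z where z: "cmod z \<le> 1" "\<not> has_inverse (1 - z *\<^sub>C b)"
    by (rule selfadjoint_resolvent_singular)
  have "has_inverse (1::'a)" by (auto simp: has_inverse_def two_sided_inverse_def)
  with z have z0: "z \<noteq> 0" by auto
  define v where "v = of_real (norm a) / z"
  have v0: "v \<noteq> 0" using z0 na by (simp add: v_def)
  have "z *\<^sub>C b = inverse v *\<^sub>C a"
    by (simp add: b_def v_def scaleC_of_real[symmetric] scaleC_scaleC divide_inverse mult_ac)
  then have "- v *\<^sub>C (1 - z *\<^sub>C b) = a - v *\<^sub>C 1"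
    using v0 by (simp add: scaleC_diff_right scaleC_scaleC scaleC_minus_left)
  with z(2) v0 have "\<not> has_inverse (a - v *\<^sub>C 1)"
    by (metis has_inverse_scaleC_iff neg_equal_0_iff_equal)
  then have "v \<in> cstar_spectrum a" by (simp add: cstar_spectrum_iff)
  then have "cmod v \<le> r" by (rule r(2))
  moreover have "norm a \<le> cmod v"
    using z(1) z0 na by (simp add: v_def norm_divide field_simps mult_left_le)
  ultimately show False using na by simp
qed

section \<open>The order of a C*-algebra\<close>

lemma spectrum_shift:
  "z \<in> cstar_spectrum (t *\<^sub>R 1 - a) \<longleftrightarrow> of_real t - z \<in> cstar_spectrum (a::'a::unital_cstar_algebra)"
proof -
  have "t *\<^sub>R 1 - a - z *\<^sub>C 1 = - (a - (of_real t - z) *\<^sub>C 1)"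
    by (simp add: scaleC_diff_left scaleC_of_real)
  then show ?thesis
    by (simp only: cstar_spectrum_iff has_inverse_minus_iff)
qed

lemma star_scaleR_one [simp]: "star (t *\<^sub>R (1::'a::unital_cstar_algebra)) = t *\<^sub>R 1"
  by (simp add: star_scaleR)

lemma cstar_positive_star: "cstar_positive a \<Longrightarrow> star a = a"
  by (simp add: cstar_positive_def)

text \<open>This and the next lemma characterise positivity by a single norm inequality. Sums, limits and
  integrals of positive elements are then handled by the triangle inequality.\<close>

lemma positive_imp_norm_le:
  assumes "cstar_positive (a::'a::unital_cstar_algebra)" "norm a \<le> t"
  shows "norm (t *\<^sub>R 1 - a) \<le> t"
proof (rule selfadjoint_norm_le)
  show "star (t *\<^sub>R 1 - a) = t *\<^sub>R 1 - a"
    using assms by (simp add: star_diff cstar_positive_star)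
  show "0 \<le> t" using assms(2) norm_ge_zero[of a] by linarith
  fix z assume "z \<in> cstar_spectrum (t *\<^sub>R 1 - a)"
  then have *: "of_real t - z \<in> cstar_spectrum a" by (simp add: spectrum_shift)
  with assms obtain s where s: "of_real t - z = of_real s" "s \<ge> 0"
    by (auto simp: cstar_positive_def)
  have "s \<le> t" using spectrum_bound[OF *] assms(2) s by simp
  moreover have "z = of_real (t - s)" using s by (simp add: algebra_simps)
  ultimately show "cmod z \<le> t" using s by (simp del: of_real_diff)
qed

lemma norm_le_imp_positive:
  assumes sa: "star (a::'a::unital_cstar_algebra) = a" and n: "norm (t *\<^sub>R 1 - a) \<le> t"
  shows "cstar_positive a"
  unfolding cstar_positive_def
proof (intro conjI sa subsetI)
  fix z assume z: "z \<in> cstar_spectrum a"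
  then have "of_real t - z \<in> cstar_spectrum (t *\<^sub>R 1 - a)" by (simp add: spectrum_shift)
  from spectrum_bound[OF this] n have "cmod (of_real t - z) \<le> t" by simp
  with abs_Re_le_cmod[of "of_real t - z"] have "Re z \<ge> 0" by simp
  moreover have "z = of_real (Re z)"
    using selfadjoint_spectrum_real[OF sa z] by (simp add: complex_eq_iff)
  ultimately show "z \<in> complex_of_real ` {0..}"
    by (metis atLeast_iff imageI)
qed

lemma positive_add:
  assumes "cstar_positive a" "cstar_positive (b::'a::unital_cstar_algebra)"
  shows "cstar_positive (a + b)"
proof (rule norm_le_imp_positive)
  show "star (a + b) = a + b" using assms by (simp add: star_add cstar_positive_star)
  have "(norm a + norm b) *\<^sub>R 1 - (a + b) = (norm a *\<^sub>R 1 - a) + (norm b *\<^sub>R 1 - b)"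
    by (simp add: scaleR_add_left)
  then show "norm ((norm a + norm b) *\<^sub>R 1 - (a + b)) \<le> norm a + norm b"
    using norm_triangle_ineq[of "norm a *\<^sub>R 1 - a" "norm b *\<^sub>R 1 - b"]
      positive_imp_norm_le[OF assms(1) order.refl] positive_imp_norm_le[OF assms(2) order.refl]
    by (metis (no_types, lifting) add_mono order_trans)
qed

lemma positive_scaleR:
  assumes "cstar_positive (a::'a::unital_cstar_algebra)" "r \<ge> 0"
  shows "cstar_positive (r *\<^sub>R a)"
proof (rule norm_le_imp_positive)
  show "star (r *\<^sub>R a) = r *\<^sub>R a" using assms by (simp add: star_scaleR cstar_positive_star)
  have "(r * norm a) *\<^sub>R 1 - r *\<^sub>R a = r *\<^sub>R (norm a *\<^sub>R 1 - a)"
    by (simp add: scaleR_diff_right)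
  then show "norm ((r * norm a) *\<^sub>R 1 - r *\<^sub>R a) \<le> r * norm a"
    using assms(2) positive_imp_norm_le[OF assms(1) order.refl] by (simp add: mult_left_mono)
qed

lemma positive_limit:
  assumes f: "\<And>n. cstar_positive (f n)" and lim: "f \<longlonglongrightarrow> (a::'a::unital_cstar_algebra)"
  shows "cstar_positive a"
proof (rule norm_le_imp_positive)
  have "(\<lambda>n. star (f n)) \<longlonglongrightarrow> star a"
    by (rule bounded_linear.tendsto[OF bounded_linear_star lim])
  with f have "f \<longlonglongrightarrow> star a" by (simp add: cstar_positive_star)
  with lim show "star a = a" by (metis LIMSEQ_unique)
  show "norm (norm a *\<^sub>R 1 - a) \<le> norm a"
  proof (rule LIMSEQ_le)
    show "(\<lambda>n. norm (norm (f n) *\<^sub>R 1 - f n)) \<longlonglongrightarrow> norm (norm a *\<^sub>R 1 - a)"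
      by (intro tendsto_intros lim)
    show "(\<lambda>n. norm (f n)) \<longlonglongrightarrow> norm a" by (intro tendsto_intros lim)
    show "\<exists>N. \<forall>n\<ge>N. norm (norm (f n) *\<^sub>R 1 - f n) \<le> norm (f n)"
      using positive_imp_norm_le[OF f order.refl] by blast
  qed
qed

lemma cstar_le_trans: "a \<le>\<^sub>A b \<Longrightarrow> b \<le>\<^sub>A c \<Longrightarrow> a \<le>\<^sub>A (c::'a::unital_cstar_algebra)"
  unfolding cstar_le_def using positive_add[of "b - a" "c - b"] by (simp add: algebra_simps)

lemma cstar_le_scaleR: "a \<le>\<^sub>A b \<Longrightarrow> r \<ge> 0 \<Longrightarrow> r *\<^sub>R a \<le>\<^sub>A r *\<^sub>R (b::'a::unital_cstar_algebra)"
  unfolding cstar_le_def using positive_scaleR[of "b - a" r] by (simp add: scaleR_diff_right)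

lemma selfadjoint_le_norm:
  assumes sa: "star a = a" and n: "norm a \<le> t"
  shows "a \<le>\<^sub>A t *\<^sub>R (1::'a::unital_cstar_algebra)"
  unfolding cstar_le_def
  by (rule norm_le_imp_positive[of _ t]) (simp_all add: sa n star_diff)

lemma positive_le_imp_norm_le:
  assumes a: "cstar_positive a" and le: "a \<le>\<^sub>A t *\<^sub>R (1::'a::unital_cstar_algebra)" and t: "0 \<le> t"
  shows "norm a \<le> t"
proof (rule selfadjoint_norm_le)
  show "star a = a" using a by (rule cstar_positive_star)
  fix z assume z: "z \<in> cstar_spectrum a"
  then obtain s where s: "z = of_real s" "s \<ge> 0" using a by (auto simp: cstar_positive_def)
  have "of_real t - z \<in> cstar_spectrum (t *\<^sub>R 1 - a)" using z by (simp add: spectrum_shift)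
  with le obtain r where "of_real t - z = of_real r" "r \<ge> 0"
    by (auto simp: cstar_le_def cstar_positive_def)
  then have "t - s = r" by (simp add: s flip: of_real_diff)
  with \<open>r \<ge> 0\<close> s show "cmod z \<le> t" by simp
qed (fact t)

lemma positive_norm_mono:
  assumes a: "cstar_positive a" and le: "a \<le>\<^sub>A (b::'a::unital_cstar_algebra)"
  shows "norm a \<le> norm b"
proof (rule positive_le_imp_norm_le[OF a])
  have "cstar_positive b"
    using positive_add[OF a, of "b - a"] le by (simp add: cstar_le_def)
  then show "a \<le>\<^sub>A norm b *\<^sub>R 1"
    using cstar_le_trans[OF le] selfadjoint_le_norm cstar_positive_star by blast
qed simp

lemma positive_add_has_inverse:
  assumes "cstar_positive (b::'a::unital_cstar_algebra)" "e > 0"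
  shows "has_inverse (b + e *\<^sub>R 1)"
proof -
  have "of_real (- e) \<notin> cstar_spectrum b"
    using assms by (auto simp: cstar_positive_def simp del: of_real_minus)
  then show ?thesis
    by (simp add: cstar_spectrum_iff scaleC_minus_left scaleC_of_real)
qed

lemma positive_square:
  assumes sa: "star h = (h::'a::unital_cstar_algebra)"
  shows "cstar_positive (h * h)"
  unfolding cstar_positive_def
proof (intro conjI subsetI)
  show sa2: "star (h * h) = h * h" by (simp add: star_mult sa)
  fix z assume z: "z \<in> cstar_spectrum (h * h)"
  then have z_real: "z = of_real (Re z)"
    using selfadjoint_spectrum_real[OF sa2 z] by (simp add: complex_eq_iff)
  have "Re z \<ge> 0"
  proof (rule ccontr)
    assume neg: "\<not> Re z \<ge> 0"
    \<comment> \<open>\<open>v\<close> is an imaginary square root of \<open>z < 0\<close>, so \<open>h\<^sup>2 - z = (h - v) (h + v)\<close> is invertible.\<close>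
    define v where "v = Complex 0 (sqrt (- Re z))"
    have "v * v = z"
      using neg z_real by (simp add: v_def complex_eq_iff)
    then have fac: "h * h - z *\<^sub>C 1 = (h - v *\<^sub>C 1) * (h - (- v) *\<^sub>C 1)"
      by (simp add: algebra_simps mult_scaleC_left mult_scaleC_right scaleC_minus_left
          scaleC_scaleC scaleC_add_right scaleC_diff_right)
    have "v \<notin> cstar_spectrum h" "- v \<notin> cstar_spectrum h"
      using selfadjoint_spectrum_real[OF sa] neg by (force simp: v_def)+
    then have "has_inverse ((h - v *\<^sub>C 1) * (h - (- v) *\<^sub>C 1))"
      by (simp only: cstar_spectrum_iff not_not has_inverse_mult)
    with z fac show False by (simp add: cstar_spectrum_iff)
  qed
  then show "z \<in> complex_of_real ` {0..}"
    using z_real by (metis atLeast_iff imageI)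
qed

text \<open>The spectrum of \<open>h\<^sup>2\<close> consists of the inverses of the spectral values of \<open>k\<^sup>2\<close>, which are
  bounded by \<open>\<parallel>k\<^sup>2\<parallel>\<close>; hence it stays away from \<open>0\<close>.\<close>

lemma inverse_square_bounded_below:
  assumes hk: "two_sided_inverse k (h::'a::unital_cstar_algebra)" and sa: "star h = h"
  obtains d where "d > 0" "cstar_positive (h * h - d *\<^sub>R 1)"
proof -
  \<comment> \<open>The summand \<open>1\<close> keeps the denominator positive in the zero algebra.\<close>
  define d where "d = 1 / (norm (k * k) + 1)"
  have pos: "norm (k * k) + 1 > 0" by (simp add: add_nonneg_pos)
  have inv: "two_sided_inverse (h * h) (k * k)"
    using two_sided_inverse_mult[OF hk hk] by (auto simp: two_sided_inverse_def)
  have "cstar_positive (h * h - d *\<^sub>R 1)"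
    unfolding cstar_positive_def
  proof (intro conjI subsetI)
    show sa2: "star (h * h - d *\<^sub>R 1) = h * h - d *\<^sub>R 1"
      by (simp add: star_diff star_mult sa)
    fix z assume z: "z \<in> cstar_spectrum (h * h - d *\<^sub>R 1)"
    have eq: "h * h - d *\<^sub>R 1 - z *\<^sub>C 1 = h * h - (z + of_real d) *\<^sub>C 1"
      by (simp add: scaleC_add_left scaleC_of_real)
    define v where "v = z + of_real d"
    have v: "\<not> has_inverse (h * h - v *\<^sub>C 1)"
      using z by (simp only: cstar_spectrum_iff eq v_def not_False_eq_True)
    have v0: "v \<noteq> 0"
      using v inv by (auto simp: has_inverse_def)
    have "(- v) *\<^sub>C ((h * h) * (k * k - inverse v *\<^sub>C 1)) = h * h - v *\<^sub>C 1"
      using inv v0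
      by (simp add: two_sided_inverse_def right_diff_distrib mult_scaleC_right scaleC_diff_right
          scaleC_scaleC scaleC_minus_left)
    then have "\<not> has_inverse (k * k - inverse v *\<^sub>C 1)"
      using v v0 inv has_inverse_mult has_inverse_scaleC_iff[of "- v"]
      by (metis has_inverse_def neg_equal_0_iff_equal)
    then have "cmod (inverse v) \<le> norm (k * k)"
      by (intro spectrum_bound) (simp add: cstar_spectrum_iff)
    then have "1 \<le> cmod v * norm (k * k)"
      using v0 unfolding norm_inverse by (simp add: field_simps del: norm_mult)
    also have "\<dots> \<le> cmod v * (norm (k * k) + 1)"
      by (simp add: mult_left_mono)
    finally have "d \<le> cmod v"
      using pos by (simp add: d_def field_simps)
    moreover obtain s where "v = of_real s" "s \<ge> 0"
    proof -
      have "v \<in> cstar_spectrum (h * h)" using v by (simp add: cstar_spectrum_iff)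
      then show thesis
        using positive_square[OF sa] that by (auto simp: cstar_positive_def)
    qed
    ultimately have "z = of_real (s - d)" "s - d \<ge> 0"
      by (simp_all add: v_def algebra_simps)
    then show "z \<in> complex_of_real ` {0..}" by blast
  qed
  with that[of d] pos show thesis by (simp add: d_def)
qed

text \<open>Negative numbers are not in the spectrum of \<open>k d k\<close>: with \<open>h = k\<^sup>-\<^sup>1\<close> and \<open>t > 0\<close>,
  \<open>k d k + t = k (d + t h\<^sup>2) k\<close>, and \<open>d + t h\<^sup>2\<close> is invertible because \<open>h\<^sup>2\<close> is bounded below.\<close>

lemma positive_conjugate:
  assumes d: "cstar_positive d" and k: "star k = (k::'a::unital_cstar_algebra)"
    and h: "two_sided_inverse k h"
  shows "cstar_positive (k * d * k)"
  unfolding cstar_positive_def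
proof (intro conjI subsetI)
  show sa: "star (k * d * k) = k * d * k"
    by (simp add: star_mult k cstar_positive_star[OF d] mult.assoc)
  have sh: "star h = h"
    using two_sided_inverse_unique[OF two_sided_inverse_star[OF h, unfolded k] h] .
  fix z assume z: "z \<in> cstar_spectrum (k * d * k)"
  have z_real: "z = of_real (Re z)"
    using selfadjoint_spectrum_real[OF sa z] by (simp add: complex_eq_iff)
  have "Re z \<ge> 0"
  proof (rule ccontr)
    assume neg: "\<not> Re z \<ge> 0"
    define t where "t = - Re z"
    have t: "t > 0" "z = of_real (- t)" using neg z_real by (simp_all add: t_def)
    obtain c where c: "c > 0" "cstar_positive (h * h - c *\<^sub>R 1)"
      using inverse_square_bounded_below[OF h sh] .
    let ?e = "d + t *\<^sub>R (h * h)"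
    have "cstar_positive (d + t *\<^sub>R (h * h - c *\<^sub>R 1))"
      using positive_add[OF d positive_scaleR[OF c(2)]] t by simp
    then have "has_inverse (d + t *\<^sub>R (h * h - c *\<^sub>R 1) + (t * c) *\<^sub>R 1)"
      using t c by (intro positive_add_has_inverse) auto
    then have "has_inverse ?e" by (simp add: scaleR_diff_right)
    moreover have "has_inverse k" using h by (auto simp: has_inverse_def)
    ultimately have "has_inverse (k * ?e * k)" by (intro has_inverse_mult)
    moreover have "k * ?e * k = k * d * k - z *\<^sub>C 1"
    proof -
      have "k * (h * h) * k = (k * h) * (h * k)" by (simp add: mult.assoc)
      then have "k * (h * h) * k = 1" using h by (simp add: two_sided_inverse_def)
      then show ?thesis
        by (simp add: t(2) distrib_left distrib_right scaleC_minus_left scaleC_of_real)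
    qed
    ultimately show False using z by (simp add: cstar_spectrum_iff)
  qed
  then show "z \<in> complex_of_real ` {0..}"
    using z_real by (metis atLeast_iff imageI)
qed

section \<open>Inverse square roots\<close>

text \<open>The Taylor coefficients of \<open>(1 - x)\<^sup>-\<^sup>1\<^sup>/\<^sup>2\<close> at \<open>0\<close>.\<close>

definition inv_sqrt_coeff :: "nat \<Rightarrow> real" where
  "inv_sqrt_coeff n = (-1) ^ n * ((-1/2) gchoose n)"

text \<open>Vandermonde's identity: the square of \<open>(1 - x)\<^sup>-\<^sup>1\<^sup>/\<^sup>2\<close> is the geometric series.\<close>

lemma inv_sqrt_coeff_convolution:
  "(\<Sum>i\<le>n. inv_sqrt_coeff i * inv_sqrt_coeff (n - i)) = 1"
proof -
  have "(\<Sum>i\<le>n. inv_sqrt_coeff i * inv_sqrt_coeff (n - i)) =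
      (\<Sum>i\<le>n. (-1) ^ n * (((-1/2) gchoose i) * ((-1/2) gchoose (n - i))))"
    by (intro sum.cong refl) (simp add: inv_sqrt_coeff_def flip: power_add)
  also have "\<dots> = (-1) ^ n * ((-1) gchoose n)"
    using gbinomial_Vandermonde[of "-1/2 :: real" "-1/2" n]
    by (simp add: atMost_atLeast0 flip: sum_distrib_left)
  also have "\<dots> = (1::real)"
    by (simp add: gbinomial_minus[of "1::real", simplified] binomial_gbinomial[of n n, symmetric]
        flip: power_add)
  finally show ?thesis .
qed

lemma abs_inv_sqrt_coeff_le: "\<bar>inv_sqrt_coeff n\<bar> \<le> 1"
proof (induction n)
  case (Suc n)
  have "\<bar>inv_sqrt_coeff (Suc n)\<bar> = \<bar>inv_sqrt_coeff n\<bar> * ((1/2 + n) / (1 + n))"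
    by (simp add: inv_sqrt_coeff_def gbinomial_absorb_comp gbinomial_Suc_rec abs_mult add.commute)
  also have "\<dots> \<le> 1 * 1"
    using Suc by (intro mult_mono) auto
  finally show ?case by simp
qed (simp add: inv_sqrt_coeff_def)

lemma inv_sqrt_series:
  fixes x :: "'a::unital_cstar_algebra"
  assumes nx: "norm x < 1" and sa: "star x = x"
  obtains g where "star g = g" "g * x = x * g" "g * g * (1 - x) = 1"
proof -
  define f where "f n = inv_sqrt_coeff n *\<^sub>R x ^ n" for n
  have "norm (f n) \<le> norm (x ^ n)" for n
    using abs_inv_sqrt_coeff_le[of n] by (simp add: f_def mult_left_le_one_le)
  then have sn: "summable (\<lambda>n. norm (f n))"
    using summable_comparison_test'[OF summable_norm_power[OF nx], of 0 "\<lambda>n. norm (f n)"] by simp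
  then have s: "summable f" by (rule summable_norm_cancel)
  define g where "g = suminf f"
  have star_f: "star (f n) = f n" for n
  proof -
    have "star (x ^ n) = x ^ n"
      by (induction n) (simp_all add: star_mult sa power_commutes)
    then show ?thesis by (simp add: f_def star_scaleR)
  qed
  have 1: "star g = g"
    using bounded_linear.suminf[OF bounded_linear_star s] by (simp add: g_def star_f)
  have 2: "g * x = x * g"
    unfolding g_def using suminf_mult[OF s, of x] suminf_mult2[OF s, of x]
    by (simp add: f_def power_commutes)
  have "(\<Sum>i\<le>n. f i * f (n - i)) = x ^ n" for n
  proof -
    have "(\<Sum>i\<le>n. f i * f (n - i)) = (\<Sum>i\<le>n. (inv_sqrt_coeff i * inv_sqrt_coeff (n - i)) *\<^sub>R x ^ n)"
      by (intro sum.cong refl) (simp add: f_def mult.commute flip: power_add)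
    then show ?thesis
      by (simp add: inv_sqrt_coeff_convolution flip: scaleR_sum_left)
  qed
  with Cauchy_product_sums[OF sn sn] have "(\<lambda>n. x ^ n) sums (g * g)"
    by (simp add: g_def)
  then have "g * g = (\<Sum>n. x ^ n)" by (rule sums_unique)
  then have "g * g * (1 - x) = 1"
    using neumann_series[OF nx] by (simp add: two_sided_inverse_def)
  with 1 2 that show thesis by blast
qed

text \<open>Here \<open>h = (b + e)\<^sup>-\<^sup>1\<^sup>/\<^sup>2\<close> and \<open>k = (b + e)\<^sup>1\<^sup>/\<^sup>2\<close>. After division by \<open>t = e + \<parallel>b\<parallel>\<close> the element \<open>b + e\<close>
  has distance less than one from the identity, so that the binomial series applies.\<close>

lemma inverse_sqrt_exists:
  fixes b :: "'a::unital_cstar_algebra"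
  assumes b: "cstar_positive b" and e: "e > 0"
  obtains h k where "star h = h" "star k = k" "two_sided_inverse k h"
    "k * k = b + e *\<^sub>R 1" "h * (b + e *\<^sub>R 1) * h = 1"
proof -
  define t where "t = e + norm b"
  have t: "t > 0" "norm b \<le> t - e" using e by (simp_all add: t_def add_pos_nonneg)
  define c where "c = b + e *\<^sub>R 1"
  have sc: "star c = c" using cstar_positive_star[OF b] by (simp add: c_def star_add)
  define x where "x = 1 - (1/t) *\<^sub>R c"
  have "t *\<^sub>R x = (t - e) *\<^sub>R 1 - b"
    using t by (simp add: x_def c_def scaleR_diff_right scaleR_diff_left)
  then have "t * norm x = norm ((t - e) *\<^sub>R 1 - b)"
    using t by (metis abs_of_pos norm_scaleR)
  also have "\<dots> \<le> t - e" by (rule positive_imp_norm_le[OF b t(2)])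
  also have "\<dots> < t * 1" using e by simp
  finally have "norm x < 1" using t by (simp only: mult_less_cancel_left_pos)
  moreover have "star x = x" by (simp add: x_def star_diff star_scaleR sc)
  ultimately obtain g where g: "star g = g" "g * x = x * g" "g * g * (1 - x) = 1"
    using inv_sqrt_series by blast
  define h where "h = (1 / sqrt t) *\<^sub>R g"
  have sh: "star h = h" using g by (simp add: h_def star_scaleR)
  have "c = t *\<^sub>R (1 - x)" using t by (simp add: x_def)
  then have comm: "h * c = c * h"
    using g(2) by (simp add: h_def left_diff_distrib right_diff_distrib scaleR_diff_right)
  have hhc: "h * h * c = 1"
    using g(3) t unfolding \<open>c = t *\<^sub>R (1 - x)\<close> h_def
    by simp
  have hch: "h * c * h = 1" using hhc comm by (metis mult.assoc)
  define k where "k = h * c"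
  have "star k = k" by (simp add: k_def star_mult sh sc comm)
  moreover have "two_sided_inverse k h"
    using hhc hch by (simp add: two_sided_inverse_def k_def mult.assoc)
  moreover have "k * k = c"
  proof -
    have "k * k = h * (c * h) * c" by (simp add: k_def mult.assoc)
    also have "\<dots> = (h * h * c) * c" using comm by (metis mult.assoc)
    finally show ?thesis using hhc by simp
  qed
  ultimately show thesis using that sh hch by (simp add: c_def)
qed

text \<open>Replacing \<open>x\<close> by \<open>h x\<close> with \<open>h = (v x + e)\<^sup>-\<^sup>1\<^sup>/\<^sup>2\<close> makes \<open>v\<close> at most \<open>1\<close>, and an upper bound for the norm
  of a positive element is also one in the order; conjugation by \<open>h\<^sup>-\<^sup>1\<close> brings \<open>x\<close> back. The shift by
  \<open>e\<close> is there because \<open>v x\<close> itself may fail to be invertible.\<close>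

lemma comparison_of_quadratic_maps:
  fixes u v :: "'h \<Rightarrow> 'a::unital_cstar_algebra" and act :: "'a \<Rightarrow> 'h \<Rightarrow> 'h"
  assumes u: "\<And>x. cstar_positive (u x)" "\<And>a x. u (act a x) = a * u x * star a"
    and v: "\<And>x. cstar_positive (v x)" "\<And>a x. v (act a x) = a * v x * star a"
    and c: "c \<ge> 0" "\<And>x. norm (u x) \<le> c * norm (v x)"
  shows "u x \<le>\<^sub>A c *\<^sub>R v x"
proof -
  have main: "cstar_positive (c *\<^sub>R (v x + e *\<^sub>R 1) - u x)" if e: "e > 0" for e
  proof -
    obtain h k where hk: "star h = h" "star k = k" "two_sided_inverse k h"
        "k * k = v x + e *\<^sub>R 1" "h * (v x + e *\<^sub>R 1) * h = 1"
      using inverse_sqrt_exists[OF v(1) e] .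
    \<comment> \<open>The definition of \<open>h\<close> makes \<open>h (v x) h\<close> equal to \<open>1 - e h\<^sup>2\<close>, which is at most \<open>1\<close>.\<close>
    have vh: "v (act h x) = 1 - e *\<^sub>R (h * h)"
      using hk(5) by (simp add: v(2) hk(1) distrib_left distrib_right algebra_simps)
    have "cstar_positive (e *\<^sub>R (h * h))"
      using e by (intro positive_scaleR positive_square hk(1)) auto
    then have "v (act h x) \<le>\<^sub>A 1 *\<^sub>R 1"
      by (simp add: cstar_le_def vh)
    then have "norm (v (act h x)) \<le> 1"
      by (rule positive_le_imp_norm_le[OF v(1)]) simp
    then have "norm (u (act h x)) \<le> c"
      using c(2)[of "act h x"] c(1) by (meson mult_left_le order_trans)
    then have "cstar_positive (c *\<^sub>R 1 - u (act h x))"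
      using selfadjoint_le_norm[OF cstar_positive_star[OF u(1)]] by (simp add: cstar_le_def)
    from positive_conjugate[OF this hk(2,3)]
    have "cstar_positive (k * (c *\<^sub>R 1 - h * u x * h) * k)"
      by (simp add: u(2) hk(1))
    moreover have "k * (c *\<^sub>R 1 - h * u x * h) * k = c *\<^sub>R (k * k) - (k * h) * u x * (h * k)"
      by (simp add: left_diff_distrib right_diff_distrib mult.assoc)
    ultimately show ?thesis
      using hk(3,4) by (simp add: two_sided_inverse_def)
  qed
  have "(\<lambda>n. c *\<^sub>R (v x + (1 / Suc n) *\<^sub>R 1) - u x) \<longlonglongrightarrow> c *\<^sub>R (v x + 0 *\<^sub>R 1) - u x"
    by (intro tendsto_intros LIMSEQ_Suc[OF lim_1_over_n])
  from positive_limit[OF main this] show ?thesis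
    by (simp add: cstar_le_def)
qed

section \<open>Bochner integrals in arbitrary Banach spaces\<close>

lemma strongly_measurable_cong_AE:
  assumes "AE w in M. f w = g w" "strongly_measurable M f"
  shows "strongly_measurable M g"
proof -
  obtain s where s: "\<And>i::nat. simple_function M (s i)" "AE w in M. (\<lambda>i. s i w) \<longlonglongrightarrow> f w"
    using assms(2) by (auto simp: strongly_measurable_def)
  have "AE w in M. (\<lambda>i. s i w) \<longlonglongrightarrow> g w"
    using s(2) assms(1) by eventually_elim simp
  with s(1) show ?thesis by (auto simp: strongly_measurable_def)
qed

lemma has_bint_cong_AE:
  assumes eq: "AE w in M. f w = g w" and f: "has_bint M f I"
  shows "has_bint M g I"
proof -
  have "(\<integral>\<^sup>+ w. ennreal (norm (f w - s w)) \<partial>M) = (\<integral>\<^sup>+ w. ennreal (norm (g w - s w)) \<partial>M)" for s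
    using eq by (intro nn_integral_cong_AE) (auto elim: eventually_mono)
  with f strongly_measurable_cong_AE[OF eq] show ?thesis
    unfolding has_bint_def by simp
qed

text \<open>Off a null set the approximating simple functions converge everywhere. Since the measure need not be
  complete, the norm of a strongly measurable function need not be measurable; that of the
  representative is.\<close>

lemma strongly_measurable_representative:
  assumes "strongly_measurable M f"
  obtains g s where "AE w in M. f w = g w" "\<forall>i::nat. simple_function M (s i)"
    "\<forall>w. (\<lambda>i. s i w) \<longlonglongrightarrow> g w"
proof -
  obtain s where s: "\<And>i::nat. simple_function M (s i)" "AE w in M. (\<lambda>i. s i w) \<longlonglongrightarrow> f w"
    using assms by (auto simp: strongly_measurable_def)
  obtain N where N: "N \<in> null_sets M" "\<And>w. w \<in> space M - N \<Longrightarrow> (\<lambda>i. s i w) \<longlonglongrightarrow> f w"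
  proof -
    from s(2) obtain N where N: "{w \<in> space M. \<not> (\<lambda>i. s i w) \<longlonglongrightarrow> f w} \<subseteq> N" "N \<in> sets M" "emeasure M N = 0"
      by (rule AE_E)
    show thesis
      by (rule that[of N]) (use N in auto)
  qed
  let ?D = "space M - N"
  show thesis
  proof
    show "AE w in M. f w = (if w \<in> ?D then f w else 0)"
      using AE_not_in[OF N(1)] AE_space by eventually_elim simp
    show "\<forall>i. simple_function M (\<lambda>w. if w \<in> ?D then s i w else 0)"
      using N(1) by (intro allI simple_function_If_set s(1)) auto
    show "\<forall>w. (\<lambda>i. if w \<in> ?D then s i w else 0) \<longlonglongrightarrow> (if w \<in> ?D then f w else 0)"
    proof
      fix w show "(\<lambda>i. if w \<in> ?D then s i w else 0) \<longlonglongrightarrow> (if w \<in> ?D then f w else 0)"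
        by (cases "w \<in> ?D") (simp_all only: if_True if_False N(2) tendsto_const)
    qed
  qed
qed

lemma strongly_measurable_norm:
  assumes "strongly_measurable M f"
  obtains r :: "'w \<Rightarrow> real" where "r \<in> borel_measurable M" "\<forall>w. r w \<ge> 0" "AE w in M. norm (f w) = r w"
proof -
  obtain g s where gs: "AE w in M. f w = g w" "\<forall>i::nat. simple_function M (s i)"
      "\<forall>w. (\<lambda>i. s i w) \<longlonglongrightarrow> g w"
    using strongly_measurable_representative[OF assms] .
  show thesis
  proof
    show "(\<lambda>w. norm (g w)) \<in> borel_measurable M"
    proof (rule borel_measurable_LIMSEQ_real)
      show "(\<lambda>i. norm (s i w)) \<longlonglongrightarrow> norm (g w)" for w
        by (intro tendsto_norm gs(3)[rule_format])
      show "(\<lambda>w. norm (s i w)) \<in> borel_measurable M" for i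
        by (intro borel_measurable_simple_function simple_function_compose1[OF gs(2)[rule_format]])
    qed
    show "AE w in M. norm (f w) = norm (g w)"
      using gs(1) by eventually_elim simp
  qed simp
qed

lemma strongly_measurable_compose2:
  assumes f: "strongly_measurable M f" and g: "strongly_measurable M g"
    and h: "\<And>X Y x y. X \<longlonglongrightarrow> x \<Longrightarrow> Y \<longlonglongrightarrow> y \<Longrightarrow> (\<lambda>i. h (X i) (Y i)) \<longlonglongrightarrow> h x y"
  shows "strongly_measurable M (\<lambda>w. h (f w) (g w))"
proof -
  obtain s where s: "\<And>i::nat. simple_function M (s i)" "AE w in M. (\<lambda>i. s i w) \<longlonglongrightarrow> f w"
    using f by (auto simp: strongly_measurable_def)
  obtain t where t: "\<And>i::nat. simple_function M (t i)" "AE w in M. (\<lambda>i. t i w) \<longlonglongrightarrow> g w"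
    using g by (auto simp: strongly_measurable_def)
  have "AE w in M. (\<lambda>i. h (s i w) (t i w)) \<longlonglongrightarrow> h (f w) (g w)"
    using s(2) t(2) by eventually_elim (rule h)
  moreover have "simple_function M (\<lambda>w. h (s i w) (t i w))" for i
    by (rule simple_function_compose2[OF s(1) t(1)])
  ultimately show ?thesis
    unfolding strongly_measurable_def by (intro exI[of _ "\<lambda>i w. h (s i w) (t i w)"] conjI allI)
qed

lemma strongly_measurable_add:
  "strongly_measurable M f \<Longrightarrow> strongly_measurable M g \<Longrightarrow> strongly_measurable M (\<lambda>w. f w + g w)"
  by (rule strongly_measurable_compose2[where h = "(+)"]) (auto intro: tendsto_add)

lemma strongly_measurable_diff:
  "strongly_measurable M f \<Longrightarrow> strongly_measurable M g \<Longrightarrow> strongly_measurable M (\<lambda>w. f w - g w)"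
  by (rule strongly_measurable_compose2[where h = "(-)"]) (auto intro: tendsto_diff)

lemma strongly_measurable_bounded_linear:
  assumes "bounded_linear L" "strongly_measurable M f"
  shows "strongly_measurable M (\<lambda>w. L (f w))"
  using strongly_measurable_compose2[OF assms(2,2), of "\<lambda>x _. L x"] bounded_linear.tendsto[OF assms(1)]
  by blast

lemma strongly_measurable_simple: "simple_function M s \<Longrightarrow> strongly_measurable M s"
  unfolding strongly_measurable_def by (intro exI[of _ "\<lambda>_. s"]) simp

text \<open>Subadditivity of the nonnegative integral requires measurable integrands, whence the detour through
  measurable versions of the norms.\<close>

lemma nn_integral_norm_dominated:
  assumes f: "strongly_measurable M f" and g: "strongly_measurable M g"
    and le: "AE w in M. norm (h w) \<le> norm (f w) + norm (g w)"
  shows "(\<integral>\<^sup>+ w. ennreal (norm (h w)) \<partial>M) \<le>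
    (\<integral>\<^sup>+ w. ennreal (norm (f w)) \<partial>M) + (\<integral>\<^sup>+ w. ennreal (norm (g w)) \<partial>M)"
proof -
  obtain r where r: "r \<in> borel_measurable M" "\<forall>w. r w \<ge> 0" "AE w in M. norm (f w) = r w"
    using strongly_measurable_norm[OF f] .
  obtain t where t: "t \<in> borel_measurable M" "\<forall>w. t w \<ge> 0" "AE w in M. norm (g w) = t w"
    using strongly_measurable_norm[OF g] .
  have "(\<integral>\<^sup>+ w. ennreal (norm (h w)) \<partial>M) \<le> (\<integral>\<^sup>+ w. ennreal (r w) + ennreal (t w) \<partial>M)"
  proof (rule nn_integral_mono_AE)
    show "AE w in M. ennreal (norm (h w)) \<le> ennreal (r w) + ennreal (t w)"
      using le r(3) t(3) by eventually_elim (use r(2) t(2) in \<open>simp flip: ennreal_plus\<close>)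
  qed
  also have "\<dots> = (\<integral>\<^sup>+ w. ennreal (r w) \<partial>M) + (\<integral>\<^sup>+ w. ennreal (t w) \<partial>M)"
    using r(1) t(1) by (intro nn_integral_add) auto
  also have "(\<integral>\<^sup>+ w. ennreal (r w) \<partial>M) = (\<integral>\<^sup>+ w. ennreal (norm (f w)) \<partial>M)"
    using r(3) by (intro nn_integral_cong_AE) (auto elim: eventually_mono)
  also have "(\<integral>\<^sup>+ w. ennreal (t w) \<partial>M) = (\<integral>\<^sup>+ w. ennreal (norm (g w)) \<partial>M)"
    using t(3) by (intro nn_integral_cong_AE) (auto elim: eventually_mono)
  finally show ?thesis .
qed

lemma simple_bochner_integrable_imp_simple:
  "Bochner_Integration.simple_bochner_integrable M s \<Longrightarrow> simple_function M s"
  by (auto elim: simple_bochner_integrable.cases)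

lemma nn_integral_norm_simple:
  assumes "Bochner_Integration.simple_bochner_integrable M s"
  shows "(\<integral>\<^sup>+ w. ennreal (norm (s w)) \<partial>M) =
    ennreal (Bochner_Integration.simple_bochner_integral M (\<lambda>w. norm (s w)))"
  using simple_bochner_integrable_compose2[of "\<lambda>x _. norm x", OF _ assms assms]
  by (intro simple_bochner_integral_eq_nn_integral[symmetric]) auto

lemma has_bintE:
  assumes "has_bint M f I"
  obtains s where "strongly_measurable M f"
    "\<forall>i::nat. Bochner_Integration.simple_bochner_integrable M (s i)"
    "(\<lambda>i. \<integral>\<^sup>+ w. ennreal (norm (f w - s i w)) \<partial>M) \<longlonglongrightarrow> 0"
    "(\<lambda>i. Bochner_Integration.simple_bochner_integral M (s i)) \<longlonglongrightarrow> I"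
  using assms by (auto simp: has_bint_def)

lemma norm_simple_bochner_integral_le:
  assumes s: "Bochner_Integration.simple_bochner_integrable M s" and f: "strongly_measurable M f"
  shows "ennreal (norm (Bochner_Integration.simple_bochner_integral M s)) \<le>
    (\<integral>\<^sup>+ w. ennreal (norm (f w)) \<partial>M) + (\<integral>\<^sup>+ w. ennreal (norm (f w - s w)) \<partial>M)"
proof -
  have "ennreal (norm (Bochner_Integration.simple_bochner_integral M s)) \<le>
      (\<integral>\<^sup>+ w. ennreal (norm (s w)) \<partial>M)"
    unfolding nn_integral_norm_simple[OF s]
    by (intro ennreal_leI simple_bochner_integral_norm_bound s)
  also have "\<dots> \<le> (\<integral>\<^sup>+ w. ennreal (norm (f w)) \<partial>M) + (\<integral>\<^sup>+ w. ennreal (norm (f w - s w)) \<partial>M)"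
  proof (rule nn_integral_norm_dominated[OF f])
    show "strongly_measurable M (\<lambda>w. f w - s w)"
      using f s simple_bochner_integrable_imp_simple strongly_measurable_diff strongly_measurable_simple
      by blast
    show "AE w in M. norm (s w) \<le> norm (f w) + norm (f w - s w)"
      using norm_triangle_sub[of "s _" "f _"] by (intro AE_I2) (simp add: norm_minus_commute)
  qed
  finally show ?thesis .
qed

lemma has_bint_norm_le:
  assumes "has_bint M f I"
  shows "ennreal (norm I) \<le> (\<integral>\<^sup>+ w. ennreal (norm (f w)) \<partial>M)"
proof -
  obtain s where s: "strongly_measurable M f"
      "\<forall>i::nat. Bochner_Integration.simple_bochner_integrable M (s i)"
      "(\<lambda>i. \<integral>\<^sup>+ w. ennreal (norm (f w - s i w)) \<partial>M) \<longlonglongrightarrow> 0"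
      "(\<lambda>i. Bochner_Integration.simple_bochner_integral M (s i)) \<longlonglongrightarrow> I"
    using has_bintE[OF assms] .
  show ?thesis
  proof (rule LIMSEQ_le)
    show "(\<lambda>i. ennreal (norm (Bochner_Integration.simple_bochner_integral M (s i)))) \<longlonglongrightarrow> ennreal (norm I)"
      by (intro tendsto_intros s(4))
    have "(\<lambda>i. (\<integral>\<^sup>+ w. ennreal (norm (f w)) \<partial>M) + (\<integral>\<^sup>+ w. ennreal (norm (f w - s i w)) \<partial>M))
        \<longlonglongrightarrow> (\<integral>\<^sup>+ w. ennreal (norm (f w)) \<partial>M) + 0"
      by (intro tendsto_add tendsto_const s(3))
    then show "(\<lambda>i. (\<integral>\<^sup>+ w. ennreal (norm (f w)) \<partial>M) + (\<integral>\<^sup>+ w. ennreal (norm (f w - s i w)) \<partial>M))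
        \<longlonglongrightarrow> (\<integral>\<^sup>+ w. ennreal (norm (f w)) \<partial>M)" by simp
    show "\<exists>N. \<forall>i\<ge>N. ennreal (norm (Bochner_Integration.simple_bochner_integral M (s i))) \<le>
        (\<integral>\<^sup>+ w. ennreal (norm (f w)) \<partial>M) + (\<integral>\<^sup>+ w. ennreal (norm (f w - s i w)) \<partial>M)"
      using norm_simple_bochner_integral_le[OF s(2)[rule_format] s(1)] by blast
  qed
qed

lemma has_bint_finite_norm:
  assumes "has_bint M f I"
  shows "(\<integral>\<^sup>+ w. ennreal (norm (f w)) \<partial>M) < \<infinity>"
proof -
  obtain s where s: "strongly_measurable M f"
      "\<forall>i::nat. Bochner_Integration.simple_bochner_integrable M (s i)"
      "(\<lambda>i. \<integral>\<^sup>+ w. ennreal (norm (f w - s i w)) \<partial>M) \<longlonglongrightarrow> 0"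
    using has_bintE[OF assms] .
  from order_tendstoD(2)[OF s(3), of 1] obtain i
    where i: "(\<integral>\<^sup>+ w. ennreal (norm (f w - s i w)) \<partial>M) < 1"
    by (auto simp: eventually_sequentially)
  have si: "strongly_measurable M (s i)"
    using s(2)[rule_format] simple_bochner_integrable_imp_simple strongly_measurable_simple by blast
  have "(\<integral>\<^sup>+ w. ennreal (norm (f w)) \<partial>M) \<le>
      (\<integral>\<^sup>+ w. ennreal (norm (f w - s i w)) \<partial>M) + (\<integral>\<^sup>+ w. ennreal (norm (s i w)) \<partial>M)"
  proof (rule nn_integral_norm_dominated[OF strongly_measurable_diff[OF s(1) si] si])
    show "AE w in M. norm (f w) \<le> norm (f w - s i w) + norm (s i w)"
      using norm_triangle_sub[of "f _" "s i _"] by (intro AE_I2) (simp add: add.commute)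
  qed
  also have "\<dots> < \<infinity>"
    unfolding nn_integral_norm_simple[OF s(2)[rule_format]]
    using order.strict_trans[OF i ennreal_one_less_top] by simp
  finally show ?thesis .
qed

lemma ennreal_squeeze_zero:
  fixes f g :: "nat \<Rightarrow> ennreal"
  assumes "\<And>i. f i \<le> g i" "g \<longlonglongrightarrow> 0"
  shows "f \<longlonglongrightarrow> 0"
  by (rule tendsto_sandwich[OF _ _ tendsto_const assms(2)]) (simp_all add: assms(1))

lemma has_bint_add:
  assumes "has_bint M f I" "has_bint M g J"
  shows "has_bint M (\<lambda>w. f w + g w) (I + J)"
proof -
  obtain s where s: "strongly_measurable M f"
      "\<forall>i::nat. Bochner_Integration.simple_bochner_integrable M (s i)"
      "(\<lambda>i. \<integral>\<^sup>+ w. ennreal (norm (f w - s i w)) \<partial>M) \<longlonglongrightarrow> 0"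
      "(\<lambda>i. Bochner_Integration.simple_bochner_integral M (s i)) \<longlonglongrightarrow> I"
    using has_bintE[OF assms(1)] .
  obtain t where t: "strongly_measurable M g"
      "\<forall>i::nat. Bochner_Integration.simple_bochner_integrable M (t i)"
      "(\<lambda>i. \<integral>\<^sup>+ w. ennreal (norm (g w - t i w)) \<partial>M) \<longlonglongrightarrow> 0"
      "(\<lambda>i. Bochner_Integration.simple_bochner_integral M (t i)) \<longlonglongrightarrow> J"
    using has_bintE[OF assms(2)] .
  have sm: "strongly_measurable M (\<lambda>w. f w - s i w)" "strongly_measurable M (\<lambda>w. g w - t i w)" for i
    by (rule strongly_measurable_diff[OF _ strongly_measurable_simple[OF simple_bochner_integrable_imp_simple]],
        rule s(1) t(1), rule s(2)[rule_format] t(2)[rule_format])+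
  let ?u = "\<lambda>i w. s i w + t i w"
  have "(\<lambda>i. \<integral>\<^sup>+ w. ennreal (norm (f w + g w - ?u i w)) \<partial>M) \<longlonglongrightarrow> 0"
  proof (rule ennreal_squeeze_zero)
    show "(\<integral>\<^sup>+ w. ennreal (norm (f w + g w - ?u i w)) \<partial>M) \<le>
        (\<integral>\<^sup>+ w. ennreal (norm (f w - s i w)) \<partial>M) + (\<integral>\<^sup>+ w. ennreal (norm (g w - t i w)) \<partial>M)" for i
      by (intro nn_integral_norm_dominated[OF sm] AE_I2 norm_diff_triangle_ineq)
    show "(\<lambda>i. (\<integral>\<^sup>+ w. ennreal (norm (f w - s i w)) \<partial>M) + (\<integral>\<^sup>+ w. ennreal (norm (g w - t i w)) \<partial>M))
        \<longlonglongrightarrow> 0"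
      using tendsto_add[OF s(3) t(3)] by simp
  qed
  moreover have "(\<lambda>i. Bochner_Integration.simple_bochner_integral M (?u i)) \<longlonglongrightarrow> I + J"
    using tendsto_add[OF s(4) t(4)] by (simp add: simple_bochner_integral_add[OF s(2)[rule_format] t(2)[rule_format]])
  moreover have "Bochner_Integration.simple_bochner_integrable M (?u i)" for i
    by (rule simple_bochner_integrable_compose2[OF _ s(2)[rule_format] t(2)[rule_format]]) simp
  ultimately show ?thesis
    unfolding has_bint_def
    by (intro conjI exI[of _ ?u] allI strongly_measurable_add[OF s(1) t(1)])
qed

lemma has_bint_bounded_linear:
  assumes L: "bounded_linear L" and f: "has_bint M f I"
  shows "has_bint M (\<lambda>w. L (f w)) (L I)"
proof -
  obtain s where s: "strongly_measurable M f"
      "\<forall>i::nat. Bochner_Integration.simple_bochner_integrable M (s i)"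
      "(\<lambda>i. \<integral>\<^sup>+ w. ennreal (norm (f w - s i w)) \<partial>M) \<longlonglongrightarrow> 0"
      "(\<lambda>i. Bochner_Integration.simple_bochner_integral M (s i)) \<longlonglongrightarrow> I"
    using has_bintE[OF f] .
  obtain K where K: "K \<ge> 0" "\<And>x. norm (L x) \<le> norm x * K"
    using bounded_linear.nonneg_bounded[OF L] by blast
  interpret L: bounded_linear L by (fact L)
  have "(\<integral>\<^sup>+ w. ennreal (norm (L (f w) - L (s i w))) \<partial>M) \<le>
      ennreal K * (\<integral>\<^sup>+ w. ennreal (norm (f w - s i w)) \<partial>M)" for i
  proof -
    obtain r where r: "r \<in> borel_measurable M" "\<forall>w. r w \<ge> 0" "AE w in M. norm (f w - s i w) = r w"
      using strongly_measurable_norm[OF strongly_measurable_diff[OF s(1)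
            strongly_measurable_simple[OF simple_bochner_integrable_imp_simple[OF s(2)[rule_format, of i]]]]] .
    have "(\<integral>\<^sup>+ w. ennreal (norm (L (f w) - L (s i w))) \<partial>M) \<le> (\<integral>\<^sup>+ w. ennreal K * ennreal (r w) \<partial>M)"
    proof (rule nn_integral_mono_AE)
      show "AE w in M. ennreal (norm (L (f w) - L (s i w))) \<le> ennreal K * ennreal (r w)"
        using r(3)
      proof eventually_elim
        case (elim w)
        have "norm (L (f w) - L (s i w)) \<le> K * r w"
          using K(2)[of "f w - s i w"] elim by (simp add: L.diff mult.commute)
        then show ?case
          using K(1) r(2) by (simp add: ennreal_leI flip: ennreal_mult)
      qed
    qed
    also have "\<dots> = ennreal K * (\<integral>\<^sup>+ w. ennreal (r w) \<partial>M)"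
      using r(1) by (intro nn_integral_cmult) auto
    also have "(\<integral>\<^sup>+ w. ennreal (r w) \<partial>M) = (\<integral>\<^sup>+ w. ennreal (norm (f w - s i w)) \<partial>M)"
      using r(3) by (intro nn_integral_cong_AE) (auto elim: eventually_mono)
    finally show ?thesis .
  qed
  moreover have "(\<lambda>i. ennreal K * (\<integral>\<^sup>+ w. ennreal (norm (f w - s i w)) \<partial>M)) \<longlonglongrightarrow> 0"
    using ennreal_tendsto_cmult[OF _ s(3), of "ennreal K"] by simp
  ultimately have "(\<lambda>i. \<integral>\<^sup>+ w. ennreal (norm (L (f w) - L (s i w))) \<partial>M) \<longlonglongrightarrow> 0"
    by (rule ennreal_squeeze_zero)
  moreover have "(\<lambda>i. Bochner_Integration.simple_bochner_integral M (\<lambda>w. L (s i w))) \<longlonglongrightarrow> L I"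
    using L.tendsto[OF s(4)] by (simp add: simple_bochner_integral_linear[OF L.linear s(2)[rule_format]])
  moreover have "Bochner_Integration.simple_bochner_integrable M (\<lambda>w. L (s i w))" for i
    using simple_bochner_integrable_compose2[of "\<lambda>x _. L x", OF _ s(2)[rule_format, of i] s(2)[rule_format, of i]]
    by (simp add: L.zero)
  ultimately show ?thesis
    unfolding has_bint_def
    by (intro conjI exI[of _ "\<lambda>i w. L (s i w)"] allI strongly_measurable_bounded_linear[OF L s(1)])
qed

lemma has_bint_diff:
  assumes "has_bint M f I" "has_bint M g J"
  shows "has_bint M (\<lambda>w. f w - g w) (I - J)"
  using has_bint_add[OF assms(1) has_bint_bounded_linear[OF bounded_linear_minus[OF bounded_linear_ident] assms(2)]]
  by simp

lemma has_bint_unique: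
  assumes "has_bint M f I" "has_bint M f J"
  shows "I = J"
  using has_bint_norm_le[OF has_bint_diff[OF assms]] by simp

lemma bint_eq: "has_bint M f I \<Longrightarrow> bint M f = I"
  unfolding bint_def using has_bint_unique by blast

lemma has_bint_bint: "bintegrable M f \<Longrightarrow> has_bint M f (bint M f)"
  using bint_eq unfolding bintegrable_def by blast

lemma bint_cong_AE: "AE w in M. f w = g w \<Longrightarrow> bintegrable M f \<Longrightarrow> bint M f = bint M g"
  using bint_eq has_bint_bint has_bint_cong_AE by metis

text \<open>Bochner's criterion. Cutting off the approximating simple functions where their norm exceeds
  twice that of the limit keeps the pointwise convergence and makes dominated convergence
  applicable; completeness of the space then provides the limit of the integrals.\<close>

lemma bintegrableI_finite_norm:
  fixes f :: "'w \<Rightarrow> 'b::banach"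
  assumes f: "strongly_measurable M f" and fin: "(\<integral>\<^sup>+ w. ennreal (norm (f w)) \<partial>M) < \<infinity>"
  shows "bintegrable M f"
proof -
  obtain g s where gs: "AE w in M. f w = g w" "\<forall>i::nat. simple_function M (s i)"
      "\<forall>w. (\<lambda>i. s i w) \<longlonglongrightarrow> g w"
    using strongly_measurable_representative[OF f] .
  have lim_meas: "(\<lambda>w. norm (g w - t w)) \<in> borel_measurable M" if "simple_function M t" for t
  proof (rule borel_measurable_LIMSEQ_real)
    show "(\<lambda>i. norm (s i w - t w)) \<longlonglongrightarrow> norm (g w - t w)" for w
      by (intro tendsto_intros gs(3)[rule_format])
    show "(\<lambda>w. norm (s i w - t w)) \<in> borel_measurable M" for i
      by (rule borel_measurable_simple_function[OF simple_function_compose2[OF gs(2)[rule_format] that]])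
  qed
  have ng: "(\<lambda>w. norm (g w)) \<in> borel_measurable M"
    using lim_meas[of "\<lambda>_. 0"] by simp
  have fin_g: "(\<integral>\<^sup>+ w. ennreal (norm (g w)) \<partial>M) < \<infinity>"
  proof -
    have "(\<integral>\<^sup>+ w. ennreal (norm (g w)) \<partial>M) = (\<integral>\<^sup>+ w. ennreal (norm (f w)) \<partial>M)"
      using gs(1) by (intro nn_integral_cong_AE) (auto elim: eventually_mono)
    with fin show ?thesis by simp
  qed
  \<comment> \<open>Where \<open>g\<close> vanishes this forces \<open>t i\<close> to vanish as well; elsewhere the cut-off is eventually inactive.\<close>
  define t where "t i w = (if norm (s i w) \<le> 2 * norm (g w) then s i w else 0)" for i w
  have t_simple: "simple_function M (t i)" for i
  proof -
    have [measurable]: "(\<lambda>w. norm (s i w)) \<in> borel_measurable M" "(\<lambda>w. norm (g w)) \<in> borel_measurable M"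
      by (intro borel_measurable_simple_function simple_function_compose1[OF gs(2)[rule_format]]) (fact ng)
    show ?thesis
      unfolding t_def by (intro simple_function_If gs(2)[rule_format]) (simp, measurable)
  qed
  have t_lim: "(\<lambda>i. t i w) \<longlonglongrightarrow> g w" for w
  proof (cases "g w = 0")
    case True
    then have "t i w = 0" for i by (simp add: t_def)
    with True show ?thesis by simp
  next
    case False
    have "(\<lambda>i. norm (s i w)) \<longlonglongrightarrow> norm (g w)" by (intro tendsto_norm gs(3)[rule_format])
    then have "\<forall>\<^sub>F i in sequentially. norm (s i w) < 2 * norm (g w)"
      using False by (intro order_tendstoD) auto
    then have "\<forall>\<^sub>F i in sequentially. s i w = t i w"
      by eventually_elim (simp add: t_def)
    from Lim_transform_eventually[OF gs(3)[rule_format] this] show ?thesis .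
  qed
  have t_le: "norm (t i w) \<le> 2 * norm (g w)" for i w by (simp add: t_def)
  have t_int: "Bochner_Integration.simple_bochner_integrable M (t i)" for i
  proof (rule simple_bochner_integrableI_bounded[OF t_simple])
    have "(\<integral>\<^sup>+ w. ennreal (norm (t i w)) \<partial>M) \<le> (\<integral>\<^sup>+ w. 2 * ennreal (norm (g w)) \<partial>M)"
      using t_le by (intro nn_integral_mono) (simp add: ennreal_leI flip: ennreal_numeral ennreal_mult)
    also have "\<dots> < \<infinity>"
      using fin_g ng by (simp add: nn_integral_cmult ennreal_mult_less_top)
    finally show "(\<integral>\<^sup>+ w. ennreal (norm (t i w)) \<partial>M) < \<infinity>" .
  qed
  have conv: "(\<lambda>i. \<integral>\<^sup>+ w. ennreal (norm (g w - t i w)) \<partial>M) \<longlonglongrightarrow> (\<integral>\<^sup>+ w. 0 \<partial>M)"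
  proof (rule nn_integral_dominated_convergence[where w = "\<lambda>w. 3 * ennreal (norm (g w))"])
    show "(\<lambda>w. ennreal (norm (g w - t i w))) \<in> borel_measurable M" for i
      using lim_meas[OF t_simple] by simp
    show "(\<lambda>w. 3 * ennreal (norm (g w))) \<in> borel_measurable M"
      using ng by simp
    show "(\<integral>\<^sup>+ w. 3 * ennreal (norm (g w)) \<partial>M) < \<infinity>"
      using fin_g ng by (simp add: nn_integral_cmult ennreal_mult_less_top)
    show "AE w in M. ennreal (norm (g w - t i w)) \<le> 3 * ennreal (norm (g w))" for i
    proof (rule AE_I2)
      fix w
      have "norm (g w - t i w) \<le> 3 * norm (g w)"
        using norm_triangle_ineq4[of "g w" "t i w"] t_le[of i w] by simp
      then show "ennreal (norm (g w - t i w)) \<le> 3 * ennreal (norm (g w))"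
        by (simp add: ennreal_leI flip: ennreal_numeral ennreal_mult)
    qed
    show "AE w in M. (\<lambda>i. ennreal (norm (g w - t i w))) \<longlonglongrightarrow> 0"
    proof (rule AE_I2)
      fix w
      have "(\<lambda>i. ennreal (norm (g w - t i w))) \<longlonglongrightarrow> ennreal (norm (g w - g w))"
        by (intro tendsto_intros t_lim)
      then show "(\<lambda>i. ennreal (norm (g w - t i w))) \<longlonglongrightarrow> 0" by simp
    qed
  qed simp
  let ?I = "\<lambda>i. Bochner_Integration.simple_bochner_integral M (t i)"
  let ?e = "\<lambda>i. \<integral>\<^sup>+ w. ennreal (norm (g w - t i w)) \<partial>M"
  have dist_le: "ennreal (dist (?I i) (?I j)) \<le> ?e i + ?e j" for i j
  proof -
    have "Bochner_Integration.simple_bochner_integrable M (\<lambda>w. t i w - t j w)"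
      by (rule simple_bochner_integrable_compose2[OF _ t_int t_int]) simp
    then have "ennreal (dist (?I i) (?I j)) \<le> (\<integral>\<^sup>+ w. ennreal (norm (t i w - t j w)) \<partial>M)"
      unfolding dist_norm simple_bochner_integral_diff[OF t_int t_int, symmetric]
      by (simp only: nn_integral_norm_simple) (intro ennreal_leI simple_bochner_integral_norm_bound)
    also have "\<dots> \<le> (\<integral>\<^sup>+ w. ennreal (norm (g w - t i w)) + ennreal (norm (g w - t j w)) \<partial>M)"
    proof (rule nn_integral_mono)
      fix w
      have "norm (t i w - t j w) \<le> norm (g w - t i w) + norm (g w - t j w)"
        by (metis dual_order.refl norm_diff_triangle_le norm_minus_commute)
      then show "ennreal (norm (t i w - t j w)) \<le> ennreal (norm (g w - t i w)) + ennreal (norm (g w - t j w))"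
        by (simp flip: ennreal_plus)
    qed
    also have "\<dots> = ?e i + ?e j"
      using lim_meas[OF t_simple] by (intro nn_integral_add) auto
    finally show ?thesis .
  qed
  have "Cauchy ?I"
  proof (rule metric_CauchyI)
    fix e :: real assume e: "e > 0"
    have "\<forall>\<^sub>F i in sequentially. ?e i < ennreal (e/2)"
      using conv e by (intro order_tendstoD) auto
    then obtain N where N: "\<And>i. i \<ge> N \<Longrightarrow> ?e i < ennreal (e/2)"
      by (auto simp: eventually_sequentially)
    have "dist (?I i) (?I j) < e" if "i \<ge> N" "j \<ge> N" for i j
    proof -
      have "ennreal (dist (?I i) (?I j)) < ennreal (e/2) + ennreal (e/2)"
        using order.strict_trans1[OF dist_le add_strict_mono[OF N[OF that(1)] N[OF that(2)]]] .
      also have "\<dots> = ennreal e" using e by (simp flip: ennreal_plus)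
      finally show ?thesis by (simp add: ennreal_less_iff)
    qed
    then show "\<exists>N. \<forall>i\<ge>N. \<forall>j\<ge>N. dist (?I i) (?I j) < e" by blast
  qed
  then obtain I where "?I \<longlonglongrightarrow> I"
    using Cauchy_convergent_iff convergent_def by blast
  moreover have "strongly_measurable M g"
    using gs(2,3) by (auto simp: strongly_measurable_def)
  ultimately have "has_bint M g I"
    using t_int conv unfolding has_bint_def nn_integral_const mult_zero_left
    by (intro conjI exI[of _ t] allI)
  moreover have "AE w in M. g w = f w" using gs(1) by eventually_elim simp
  ultimately show ?thesis
    unfolding bintegrable_def using has_bint_cong_AE by blast
qed

lemma bintegrable_dominated:
  fixes h :: "'w \<Rightarrow> 'b::banach"
  assumes h: "strongly_measurable M h" and "bintegrable M f" "bintegrable M g"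
    and le: "AE w in M. norm (h w) \<le> norm (f w) + norm (g w)"
  shows "bintegrable M h"
proof (rule bintegrableI_finite_norm[OF h])
  have f: "has_bint M f (bint M f)" and g: "has_bint M g (bint M g)"
    using assms has_bint_bint by blast+
  have "strongly_measurable M f" "strongly_measurable M g"
    using f g by (auto simp: has_bint_def)
  from nn_integral_norm_dominated[OF this le]
  show "(\<integral>\<^sup>+ w. ennreal (norm (h w)) \<partial>M) < \<infinity>"
    using has_bint_finite_norm[OF f] has_bint_finite_norm[OF g]
    by (auto simp: infinity_ennreal_def elim!: order.strict_trans1)
qed

text \<open>A positive \<open>f w\<close> satisfies \<open>\<parallel>r - f w\<parallel> \<le> r\<close> with \<open>r = \<parallel>f w\<parallel>\<close>. Integrating this inequality
  gives \<open>\<parallel>t - \<integral>f\<parallel> \<le> t\<close> with \<open>t = \<integral>\<parallel>f\<parallel>\<close>, which is the criterion for positivity of the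
  integral.\<close>

lemma has_bint_positive:
  fixes f :: "'w \<Rightarrow> 'a::unital_cstar_algebra"
  assumes f: "has_bint M f I" and pos: "AE w in M. cstar_positive (f w)"
  shows "cstar_positive I"
proof -
  have "AE w in M. star (f w) = f w"
    using pos by eventually_elim (rule cstar_positive_star)
  from has_bint_cong_AE[OF this has_bint_bounded_linear[OF bounded_linear_star f]]
  have star_I: "star I = I" using f by (rule has_bint_unique)
  have sm: "strongly_measurable M f" using f by (simp add: has_bint_def)
  obtain r where r: "r \<in> borel_measurable M" "\<forall>w. r w \<ge> 0" "AE w in M. norm (f w) = r w"
    using strongly_measurable_norm[OF sm] .
  have nn: "(\<integral>\<^sup>+ w. ennreal (norm (f w)) \<partial>M) = (\<integral>\<^sup>+ w. ennreal (r w) \<partial>M)"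
    using r(3) by (intro nn_integral_cong_AE) (auto elim: eventually_mono)
  have "integrable M r"
    using r(1,2) has_bint_finite_norm[OF f] nn by (intro integrableI_nonneg) auto
  define t where "t = integral\<^sup>L M r"
  have "has_bochner_integral M r t"
    unfolding t_def by (rule has_bochner_integral_integrable[OF \<open>integrable M r\<close>])
  then have "has_bint M r t"
    using has_bint_iff_has_bochner_integral[OF r(1)] by blast
  from has_bint_diff[OF has_bint_bounded_linear[OF bounded_linear_scaleR_left this] f]
  have "has_bint M (\<lambda>w. r w *\<^sub>R 1 - f w) (t *\<^sub>R 1 - I)" .
  from has_bint_norm_le[OF this]
  have "ennreal (norm (t *\<^sub>R 1 - I)) \<le> (\<integral>\<^sup>+ w. ennreal (norm (r w *\<^sub>R 1 - f w)) \<partial>M)" .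
  also have "\<dots> \<le> (\<integral>\<^sup>+ w. ennreal (r w) \<partial>M)"
  proof (rule nn_integral_mono_AE)
    show "AE w in M. ennreal (norm (r w *\<^sub>R 1 - f w)) \<le> ennreal (r w)"
      using r(3) pos by eventually_elim (simp add: ennreal_leI positive_imp_norm_le)
  qed
  also have "\<dots> = ennreal t"
    unfolding t_def using r(2) by (intro nn_integral_eq_integral \<open>integrable M r\<close>) auto
  finally have "norm (t *\<^sub>R 1 - I) \<le> t"
    using r(2) by (simp add: t_def)
  with star_I show ?thesis by (rule norm_le_imp_positive)
qed

lemma bint_mono:
  fixes f g :: "'w \<Rightarrow> 'a::unital_cstar_algebra"
  assumes "has_bint M f I" "has_bint M g J" "\<And>w. f w \<le>\<^sub>A g w"
  shows "I \<le>\<^sub>A J"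
  using has_bint_positive[OF has_bint_diff[OF assms(2,1)]] assms(3) by (simp add: cstar_le_def)

section \<open>Hilbert modules\<close>

context hilbert_module
begin

lemma ip_zero_left [simp]: "ip 0 y = 0"
  using ip_scaleC_left[of 0 0 y] by simp

lemma ip_minus_left: "ip (- x) y = - ip x y"
  using ip_scaleC_left[of "- 1" x y] by (simp add: scaleC_minus_left)

lemma ip_diff_left: "ip (x - y) z = ip x z - ip y z"
  using ip_add_left[of x "- y" z] by (simp add: ip_minus_left)

lemma ip_add_right: "ip x (y + z) = ip x y + ip x z"
  by (metis ip_add_left ip_star star_add)

lemma ip_scaleC_right: "ip x (c *\<^sub>C y) = cnj c *\<^sub>C ip x y"
  by (metis ip_scaleC_left ip_star star_scaleC)

lemma ip_act_right: "ip x (act a y) = ip x y * star a"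
  by (metis ip_act_left ip_star star_mult)

lemma ip_zero_right [simp]: "ip x 0 = 0"
  using ip_scaleC_right[of x 0 0] by simp

lemma ip_minus_right: "ip x (- y) = - ip x y"
  using ip_scaleC_right[of x "- 1" y] by (simp add: scaleC_minus_left)

lemma ip_diff_right: "ip x (y - z) = ip x y - ip x z"
  using ip_add_right[of x y "- z"] by (simp add: ip_minus_right)

lemma norm_ip_self: "norm (ip x x) = (norm x)\<^sup>2"
  by (simp add: norm_ip)

lemma ip_left_cancel:
  assumes "\<And>z. ip x z = ip y z"
  shows "x = y"
proof -
  have "ip (x - y) (x - y) = 0" by (simp add: ip_diff_left assms)
  then show ?thesis using ip_definite[of "x - y"] by simp
qed

lemma polarization:
  "4 *\<^sub>R ip x y = ip (x + y) (x + y) - ip (x - y) (x - y)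
     + \<i> *\<^sub>C ip (x + \<i> *\<^sub>C y) (x + \<i> *\<^sub>C y) - \<i> *\<^sub>C ip (x - \<i> *\<^sub>C y) (x - \<i> *\<^sub>C y)"
proof -
  have "ip (x + y) (x + y) - ip (x - y) (x - y) = 2 *\<^sub>R ip x y + 2 *\<^sub>R ip y x"
    by (simp add: ip_add_left ip_add_right ip_diff_left ip_diff_right scaleR_2)
  moreover have "ip (x + \<i> *\<^sub>C y) (x + \<i> *\<^sub>C y) - ip (x - \<i> *\<^sub>C y) (x - \<i> *\<^sub>C y) =
      2 *\<^sub>R (\<i> *\<^sub>C ip y x) - 2 *\<^sub>R (\<i> *\<^sub>C ip x y)"
    by (simp add: ip_add_left ip_add_right ip_diff_left ip_diff_right ip_scaleC_left ip_scaleC_right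
        scaleC_minus_left scaleC_add_right scaleC_diff_right scaleR_2)
  then have "\<i> *\<^sub>C ip (x + \<i> *\<^sub>C y) (x + \<i> *\<^sub>C y) - \<i> *\<^sub>C ip (x - \<i> *\<^sub>C y) (x - \<i> *\<^sub>C y) =
      \<i> *\<^sub>C (2 *\<^sub>R (\<i> *\<^sub>C ip y x) - 2 *\<^sub>R (\<i> *\<^sub>C ip x y))"
    by (simp only: flip: scaleC_diff_right)
  then have "\<i> *\<^sub>C ip (x + \<i> *\<^sub>C y) (x + \<i> *\<^sub>C y) - \<i> *\<^sub>C ip (x - \<i> *\<^sub>C y) (x - \<i> *\<^sub>C y) =
      2 *\<^sub>R ip x y - 2 *\<^sub>R ip y x"
    by (simp add: scaleR_2 scaleC_add_right scaleC_diff_right scaleC_scaleC scaleC_minus_left)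
  ultimately have "(ip (x + y) (x + y) - ip (x - y) (x - y)) +
      (\<i> *\<^sub>C ip (x + \<i> *\<^sub>C y) (x + \<i> *\<^sub>C y) - \<i> *\<^sub>C ip (x - \<i> *\<^sub>C y) (x - \<i> *\<^sub>C y))
      = 2 *\<^sub>R ip x y + 2 *\<^sub>R ip x y"
    by simp
  then show ?thesis
    by (simp add: add_diff_eq flip: scaleR_add_left)
qed

text \<open>Each of the four terms of the polarization identity has norm at most \<open>(\<parallel>x\<parallel> + \<parallel>y\<parallel>)\<^sup>2\<close>. After
  scaling to unit vectors this makes the inner product a bounded bilinear map, hence continuous.\<close>

lemma norm_ip_le: "norm (ip x y) \<le> (norm x + norm y)\<^sup>2"
proof -
  have q: "norm (ip z z) \<le> (norm x + norm y)\<^sup>2" if "norm z \<le> norm x + norm y" for z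
    using that by (simp add: norm_ip_self power_mono)
  have n: "norm (\<i> *\<^sub>C y) = norm y" by (simp add: norm_scaleC)
  let ?a = "ip (x + y) (x + y)" and ?b = "ip (x - y) (x - y)"
  let ?c = "\<i> *\<^sub>C ip (x + \<i> *\<^sub>C y) (x + \<i> *\<^sub>C y)" and ?d = "\<i> *\<^sub>C ip (x - \<i> *\<^sub>C y) (x - \<i> *\<^sub>C y)"
  have "norm (4 *\<^sub>R ip x y) \<le> norm ?a + norm ?b + norm ?c + norm ?d"
    unfolding polarization
    using norm_triangle_ineq4[of "?a - ?b + ?c" ?d] norm_triangle_ineq[of "?a - ?b" ?c]
      norm_triangle_ineq4[of ?a ?b] by linarith
  also have "\<dots> \<le> 4 * (norm x + norm y)\<^sup>2"
    using q[of "x + y"] q[of "x - y"] q[of "x + \<i> *\<^sub>C y"] q[of "x - \<i> *\<^sub>C y"]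
      norm_triangle_ineq[of x y] norm_triangle_ineq4[of x y] n
      norm_triangle_ineq[of x "\<i> *\<^sub>C y"] norm_triangle_ineq4[of x "\<i> *\<^sub>C y"]
    by (simp add: norm_scaleC)
  finally show ?thesis by simp
qed

lemma ip_scaleR_left: "ip (r *\<^sub>R x) y = r *\<^sub>R ip x y"
  using ip_scaleC_left[of "of_real r" x y] by (simp add: scaleC_of_real)

lemma ip_scaleR_right: "ip x (r *\<^sub>R y) = r *\<^sub>R ip x y"
  using ip_scaleC_right[of x "of_real r" y] by (simp add: scaleC_of_real)

lemma bounded_bilinear_ip: "bounded_bilinear ip"
proof
  show "\<exists>K. \<forall>x y. norm (ip x y) \<le> norm x * norm y * K"
  proof (intro exI[of _ 4] allI)
    fix x y :: 'h
    show "norm (ip x y) \<le> norm x * norm y * 4"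
    proof (cases "x = 0 \<or> y = 0")
      case False
      let ?x = "(1 / norm x) *\<^sub>R x" and ?y = "(1 / norm y) *\<^sub>R y"
      have "norm (ip ?x ?y) \<le> (1 + 1)\<^sup>2"
        using norm_ip_le[of ?x ?y] False by simp
      then show ?thesis
        using False by (simp add: ip_scaleR_left ip_scaleR_right field_simps)
    qed auto
  qed
qed (simp_all add: ip_add_left ip_add_right ip_scaleR_left ip_scaleR_right)

text \<open>By the parallelogram law the difference of the two sides is \<open>\<langle>x - y, x - y\<rangle>\<close>. This replaces the
  triangle inequality for square-integrable families, at the cost of a factor two.\<close>

lemma ip_parallelogram_le: "ip (x + y) (x + y) \<le>\<^sub>A 2 *\<^sub>R ip x x + 2 *\<^sub>R ip y y"
proof -
  have "2 *\<^sub>R ip x x + 2 *\<^sub>R ip y y - ip (x + y) (x + y) = ip (x - y) (x - y)"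
    by (simp add: ip_add_left ip_add_right ip_diff_left ip_diff_right scaleR_2)
  then show ?thesis
    using ip_positive by (simp add: cstar_le_def)
qed

section \<open>Adjointable operators\<close>

lemma is_module_adjoint_sym: "is_module_adjoint ip T T' \<Longrightarrow> is_module_adjoint ip T' T"
  unfolding is_module_adjoint_def by (metis ip_star)

lemma module_adjoint_adjointable:
  assumes "T \<in> adjointables ip"
  shows "module_adjoint ip T \<in> adjointables ip"
proof -
  obtain T' where T': "is_module_adjoint ip T T'"
    using assms by (auto simp: adjointables_def)
  have "U = T'" if "is_module_adjoint ip T U" for U
  proof
    fix y
    show "U y = T' y"
      using that T' unfolding is_module_adjoint_def
      by (intro ip_left_cancel) (metis ip_star)
  qed
  with T' have "module_adjoint ip T = T'"
    unfolding module_adjoint_def by (rule the_equality)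
  with is_module_adjoint_sym[OF T'] show ?thesis
    by (auto simp: adjointables_def)
qed

lemma adjointable_act:
  assumes "T \<in> adjointables ip"
  shows "T (act a x) = act a (T x)"
proof -
  obtain T' where T': "\<And>x y. ip (T x) y = ip x (T' y)"
    using assms by (auto simp: adjointables_def is_module_adjoint_def)
  show ?thesis
    by (rule ip_left_cancel) (simp add: T' ip_act_left)
qed

lemma adjointable_zero: "(\<lambda>x. 0) \<in> adjointables ip"
  unfolding adjointables_def is_module_adjoint_def by (auto intro: exI[of _ "\<lambda>_. 0"])

lemma adjointable_add:
  assumes "T \<in> adjointables ip" "U \<in> adjointables ip"
  shows "(\<lambda>x. T x + U x) \<in> adjointables ip"
proof -
  obtain T' U' where *: "\<And>x y. ip (T x) y = ip x (T' y)" "\<And>x y. ip (U x) y = ip x (U' y)"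
    using assms by (auto simp: adjointables_def is_module_adjoint_def)
  show ?thesis
    unfolding adjointables_def is_module_adjoint_def
    by (auto simp: ip_add_left ip_add_right * intro!: exI[of _ "\<lambda>y. T' y + U' y"])
qed

lemma adjointable_sum:
  assumes "finite F" "\<And>k. k \<in> F \<Longrightarrow> T k \<in> adjointables ip"
  shows "(\<lambda>x. \<Sum>k\<in>F. T k x) \<in> adjointables ip"
  using assms by (induction F) (simp_all add: adjointable_zero adjointable_add)

section \<open>Square-integrable families\<close>

abbreviation gram :: "'w measure \<Rightarrow> ('w \<Rightarrow> 'h) \<Rightarrow> 'a" where
  "gram M f \<equiv> l2_ip M ip f f"

lemma has_bint_gram:
  "f \<in> l2_space M ip \<Longrightarrow> has_bint M (\<lambda>w. ip (f w) (f w)) (gram M f)"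
  by (simp add: l2_space_def l2_ip_def has_bint_bint)

lemma gram_positive: "f \<in> l2_space M ip \<Longrightarrow> cstar_positive (gram M f)"
  using has_bint_positive[OF has_bint_gram] ip_positive by auto

lemma l2_space_add:
  assumes f: "f \<in> l2_space M ip" and g: "g \<in> l2_space M ip"
  shows "(\<lambda>w. f w + g w) \<in> l2_space M ip"
    and "norm (gram M (\<lambda>w. f w + g w)) \<le> 2 * norm (gram M f) + 2 * norm (gram M g)"
proof -
  let ?h = "\<lambda>w. f w + g w"
  have sm: "strongly_measurable M ?h"
    using f g by (simp add: l2_space_def strongly_measurable_add)
  have smq: "strongly_measurable M (\<lambda>w. ip (?h w) (?h w))"
    by (rule strongly_measurable_compose2[OF sm sm, of ip])
      (rule bounded_bilinear.tendsto[OF bounded_bilinear_ip])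
  have F: "has_bint M (\<lambda>w. 2 *\<^sub>R ip (f w) (f w)) (2 *\<^sub>R gram M f)"
    and G: "has_bint M (\<lambda>w. 2 *\<^sub>R ip (g w) (g w)) (2 *\<^sub>R gram M g)"
    using has_bint_bounded_linear[OF bounded_linear_scaleR_right has_bint_gram] f g by blast+
  have "bintegrable M (\<lambda>w. ip (?h w) (?h w))"
  proof (rule bintegrable_dominated[OF smq])
    show "bintegrable M (\<lambda>w. 2 *\<^sub>R ip (f w) (f w))" "bintegrable M (\<lambda>w. 2 *\<^sub>R ip (g w) (g w))"
      using F G by (auto simp: bintegrable_def)
    show "AE w in M. norm (ip (?h w) (?h w)) \<le> norm (2 *\<^sub>R ip (f w) (f w)) + norm (2 *\<^sub>R ip (g w) (g w))"
      using positive_norm_mono[OF ip_positive ip_parallelogram_le] norm_triangle_ineq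
      by (intro AE_I2) (rule order_trans)
  qed
  with sm show h: "?h \<in> l2_space M ip" by (simp add: l2_space_def)
  have "gram M ?h \<le>\<^sub>A 2 *\<^sub>R gram M f + 2 *\<^sub>R gram M g"
    by (rule bint_mono[OF has_bint_gram[OF h] has_bint_add[OF F G] ip_parallelogram_le])
  from positive_norm_mono[OF gram_positive[OF h] this]
  show "norm (gram M ?h) \<le> 2 * norm (gram M f) + 2 * norm (gram M g)"
    using norm_triangle_ineq[of "2 *\<^sub>R gram M f" "2 *\<^sub>R gram M g"] by simp
qed

lemma l2_space_minus:
  assumes "f \<in> l2_space M ip"
  shows "(\<lambda>w. - f w) \<in> l2_space M ip" "gram M (\<lambda>w. - f w) = gram M f"
  using assms strongly_measurable_bounded_linear[OF bounded_linear_minus[OF bounded_linear_ident]]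
  by (auto simp: l2_space_def l2_ip_def ip_minus_left ip_minus_right)

definition l2_bounded_family :: "'w measure \<Rightarrow> ('w \<Rightarrow> 'h \<Rightarrow> 'h) \<Rightarrow> bool" where
  "l2_bounded_family M F \<longleftrightarrow> (\<forall>x. (\<lambda>w. F w x) \<in> l2_space M ip) \<and>
     (\<exists>c. \<forall>x. norm (gram M (\<lambda>w. F w x)) \<le> c * (norm x)\<^sup>2)"

lemma l2_bounded_family_add:
  assumes "l2_bounded_family M F" "l2_bounded_family M G"
  shows "l2_bounded_family M (\<lambda>w x. F w x + G w x)"
proof -
  obtain c d where c: "\<And>x. norm (gram M (\<lambda>w. F w x)) \<le> c * (norm x)\<^sup>2"
    and d: "\<And>x. norm (gram M (\<lambda>w. G w x)) \<le> d * (norm x)\<^sup>2"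
    using assms by (auto simp: l2_bounded_family_def)
  have l2: "(\<lambda>w. F w x) \<in> l2_space M ip" "(\<lambda>w. G w x) \<in> l2_space M ip" for x
    using assms by (auto simp: l2_bounded_family_def)
  have "norm (gram M (\<lambda>w. F w x + G w x)) \<le> (2 * c + 2 * d) * (norm x)\<^sup>2" for x
    using l2_space_add(2)[OF l2, of x x] c[of x] d[of x] by (simp add: distrib_right)
  then show ?thesis
    using l2_space_add(1)[OF l2] unfolding l2_bounded_family_def by blast
qed

lemma l2_bounded_family_diff:
  assumes "l2_bounded_family M F" "l2_bounded_family M G"
  shows "l2_bounded_family M (\<lambda>w x. F w x - G w x)"
proof -
  have l2: "(\<lambda>w. G w x) \<in> l2_space M ip" for x
    using assms(2) by (simp add: l2_bounded_family_def)
  have "l2_bounded_family M (\<lambda>w x. - G w x)"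
    using assms(2) by (simp add: l2_bounded_family_def l2_space_minus[OF l2])
  from l2_bounded_family_add[OF assms(1) this] show ?thesis by simp
qed

lemma l2_bounded_family_sum:
  assumes "finite F" "F \<noteq> {}" "\<And>k. k \<in> F \<Longrightarrow> l2_bounded_family M (G k)"
  shows "l2_bounded_family M (\<lambda>w x. \<Sum>k\<in>F. G k w x)"
  using assms by (induction F rule: finite_ne_induct) (simp_all add: l2_bounded_family_add)

text \<open>Adjointable operators are linear over the algebra, and multiplication from both sides commutes with the
  integral.\<close>

lemma gram_act:
  assumes F: "\<And>w. w \<in> space M \<Longrightarrow> F w \<in> adjointables ip"
    and l2: "\<And>x. (\<lambda>w. F w x) \<in> l2_space M ip"
  shows "gram M (\<lambda>w. F w (act a x)) = a * gram M (\<lambda>w. F w x) * star a"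
proof -
  have "bounded_linear (\<lambda>b. a * b * star a)"
    by (intro bounded_linear_compose[OF bounded_linear_mult_left bounded_linear_mult_right])
  from has_bint_bounded_linear[OF this has_bint_gram[OF l2[of x]]]
  have "has_bint M (\<lambda>w. a * ip (F w x) (F w x) * star a) (a * gram M (\<lambda>w. F w x) * star a)" .
  moreover have "AE w in M. a * ip (F w x) (F w x) * star a = ip (F w (act a x)) (F w (act a x))"
    using AE_space
    by eventually_elim (simp add: adjointable_act[OF F] ip_act_left ip_act_right mult.assoc)
  ultimately have "has_bint M (\<lambda>w. ip (F w (act a x)) (F w (act a x))) (a * gram M (\<lambda>w. F w x) * star a)"
    by (rule has_bint_cong_AE[rotated])
  then show ?thesis
    unfolding l2_ip_def by (rule bint_eq)
qed

text \<open>Frame inequalities may be checked in norm: the upper one compares \<open>gram (F x)\<close> with \<open>\<langle>x, x\<rangle>\<close>,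
  the lower one \<open>\<langle>K\<^sup>*x, K\<^sup>*x\<rangle>\<close> with \<open>gram (F x)\<close>. All three depend on \<open>x\<close> quadratically over the
  algebra.\<close>

lemma frame_if_norm_bounds:
  assumes K: "K \<in> adjointables ip" and fam: "operator_family M ip F" and bdd: "l2_bounded_family M F"
    and low: "\<And>x. norm (ip (module_adjoint ip K x) (module_adjoint ip K x))
        \<le> c * norm (gram M (\<lambda>w. F w x))"
  shows "continuous_K_operator_frame M ip K F"
proof -
  let ?K = "module_adjoint ip K"
  obtain d where d: "\<And>x. norm (gram M (\<lambda>w. F w x)) \<le> d * (norm x)\<^sup>2"
    using bdd by (auto simp: l2_bounded_family_def)
  \<comment> \<open>Frame bounds have to be positive, which norm bounds alone do not guarantee.\<close>
  define b where "b = max 1 d"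
  define e where "e = max 1 c"
  have l2: "(\<lambda>w. F w x) \<in> l2_space M ip" for x
    using bdd by (simp add: l2_bounded_family_def)
  have adj: "F w \<in> adjointables ip" if "w \<in> space M" for w
    using fam that by (simp add: operator_family_def)
  note pos = gram_positive[OF l2] and cov = gram_act[OF adj l2]
  have upper: "gram M (\<lambda>w. F w x) \<le>\<^sub>A b *\<^sub>R ip x x" for x
  proof (rule comparison_of_quadratic_maps[where act = act])
    show "norm (gram M (\<lambda>w. F w x)) \<le> b * norm (ip x x)" for x
      using order_trans[OF d mult_right_mono[of d b "(norm x)\<^sup>2"]] by (simp add: norm_ip_self b_def)
  qed (simp_all add: pos cov ip_positive ip_act_left ip_act_right mult.assoc b_def)
  have lower: "ip (?K x) (?K x) \<le>\<^sub>A e *\<^sub>R gram M (\<lambda>w. F w x)" for x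
  proof (rule comparison_of_quadratic_maps[where act = act])
    show "norm (ip (?K x) (?K x)) \<le> e * norm (gram M (\<lambda>w. F w x))" for x
      using order_trans[OF low mult_right_mono[of c e]] by (simp add: e_def)
  qed (simp_all add: pos cov ip_positive adjointable_act[OF module_adjoint_adjointable[OF K]]
      ip_act_left ip_act_right mult.assoc e_def)
  have "e > 0" by (simp add: e_def)
  have "inverse e *\<^sub>R ip (?K x) (?K x) \<le>\<^sub>A gram M (\<lambda>w. F w x)" for x
    using cstar_le_scaleR[OF lower[of x], of "inverse e"] \<open>e > 0\<close> by simp
  then have "K_operator_frame_bounds M ip K F (inverse e) b"
    using upper l2 fam \<open>e > 0\<close>
    by (auto simp: K_operator_frame_bounds_def l2_space_def l2_ip_def b_def)
  then show ?thesis
    unfolding continuous_K_operator_frame_def by blast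
qed

end

theorem theorem5p6:
  fixes M :: "'w measure"
    and act :: "'a::unital_cstar_algebra \<Rightarrow> 'h::{complex_normed_space, banach} \<Rightarrow> 'h"
    and ip :: "'h \<Rightarrow> 'h \<Rightarrow> 'a"
    and K :: "'h \<Rightarrow> 'h"
    and n p :: nat
    and T R :: "nat \<Rightarrow> 'w \<Rightarrow> 'h \<Rightarrow> 'h"
    and A B :: "nat \<Rightarrow> real"
    and S :: "('w \<Rightarrow> 'h) \<Rightarrow> ('w \<Rightarrow> 'h)"
    and lam :: real
  assumes "hilbert_module act ip"
    and "K \<in> adjointables ip"
    and "\<And>k. k \<in> {1..n} \<Longrightarrow> K_operator_frame_bounds M ip K (T k) (A k) (B k)"
    and "\<And>k. k \<in> {1..n} \<Longrightarrow> operator_family M ip (R k)"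
    and "l2_bounded_linear M ip S"
    and "p \<in> {1..n}"
    and "\<And>x. AE w in M. S (\<lambda>v. \<Sum>k=1..n. R k v x) w = T p w x"
    and "lam > 0"
    and "\<And>k x. k \<in> {1..n} \<Longrightarrow>
           bintegrable M (\<lambda>w. ip (T k w x - R k w x) (T k w x - R k w x)) \<and>
           norm (bint M (\<lambda>w. ip (T k w x - R k w x) (T k w x - R k w x)))
             \<le> lam * norm (bint M (\<lambda>w. ip (T k w x) (T k w x)))"
  shows "continuous_K_operator_frame M ip K (\<lambda>w x. \<Sum>k=1..n. R k w x)"
proof -
  interpret hilbert_module act ip by fact
  note K = assms(2) and T = assms(3) and R = assms(4) and S = assms(5) and p = assms(6)
    and S_eq = assms(7) and lam = assms(8) and close = assms(9)
  let ?K = "module_adjoint ip K"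
  have T_l2: "(\<lambda>w. T k w x) \<in> l2_space M ip" if "k \<in> {1..n}" for k x
    using T[OF that] by (simp add: K_operator_frame_bounds_def operator_family_def l2_space_def)
  have T_bound: "norm (gram M (\<lambda>w. T k w x)) \<le> B k * (norm x)\<^sup>2" if "k \<in> {1..n}" for k x
    using positive_norm_mono[OF gram_positive[OF T_l2[OF that, of x]], of "B k *\<^sub>R ip x x"] T[OF that]
    by (simp add: K_operator_frame_bounds_def l2_ip_def norm_ip_self)
  have R_bdd: "l2_bounded_family M (R k)" if k: "k \<in> {1..n}" for k
  proof -
    have T_bdd: "l2_bounded_family M (T k)"
      using T_l2[OF k] T_bound[OF k] by (auto simp: l2_bounded_family_def)
    have "(\<lambda>w. T k w x - R k w x) \<in> l2_space M ip" for x
      using T[OF k] R[OF k] close[OF k]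
      by (simp add: l2_space_def K_operator_frame_bounds_def operator_family_def strongly_measurable_diff)
    moreover have "norm (gram M (\<lambda>w. T k w x - R k w x)) \<le> (lam * B k) * (norm x)\<^sup>2" for x
      using order_trans[OF conjunct2[OF close[OF k, of x]]
          mult_left_mono[OF T_bound[OF k, of x, unfolded l2_ip_def] less_imp_le[OF lam]]]
      by (simp add: l2_ip_def mult.assoc)
    ultimately have "l2_bounded_family M (\<lambda>w x. T k w x - R k w x)"
      unfolding l2_bounded_family_def by blast
    from l2_bounded_family_diff[OF T_bdd this] show ?thesis by simp
  qed
  let ?F = "\<lambda>w x. \<Sum>k=1..n. R k w x"
  have F_bdd: "l2_bounded_family M ?F"
    using p R_bdd by (intro l2_bounded_family_sum) auto
  then have F_l2: "(\<lambda>w. ?F w x) \<in> l2_space M ip" for x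
    by (simp add: l2_bounded_family_def)
  obtain C where C: "\<forall>f\<in>l2_space M ip. l2_norm M ip (S f) \<le> C * l2_norm M ip f"
    using S unfolding l2_bounded_linear_def by blast
  have Ap: "A p > 0" using T[OF p] by (simp add: K_operator_frame_bounds_def)
  \<comment> \<open>\<open>S\<close> controls norms only, so the lower frame bound of \<open>T p\<close> can be carried over to \<open>?F\<close> only in norm.\<close>
  have low: "norm (ip (?K x) (?K x)) \<le> (C\<^sup>2 / A p) * norm (gram M (\<lambda>w. ?F w x))" for x
  proof -
    let ?f = "\<lambda>w. ?F w x"
    have Sf: "S ?f \<in> l2_space M ip"
      using S F_l2 by (simp add: l2_bounded_linear_def)
    have "gram M (S ?f) = gram M (\<lambda>w. T p w x)"
      unfolding l2_ip_def
    proof (rule bint_cong_AE)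
      show "AE w in M. ip (S ?f w) (S ?f w) = ip (T p w x) (T p w x)"
        using S_eq[of x] by eventually_elim simp
      show "bintegrable M (\<lambda>w. ip (S ?f w) (S ?f w))"
        using Sf by (simp add: l2_space_def)
    qed
    moreover have "norm (gram M (S ?f)) \<le> C\<^sup>2 * norm (gram M ?f)"
      using power_mono[OF bspec[OF C F_l2[of x]], of 2]
      by (simp add: l2_norm_def power_mult_distrib)
    moreover have "cstar_positive (A p *\<^sub>R ip (?K x) (?K x))"
      using Ap by (intro positive_scaleR ip_positive) simp
    then have "norm (A p *\<^sub>R ip (?K x) (?K x)) \<le> norm (gram M (\<lambda>w. T p w x))"
      by (rule positive_norm_mono) (use T[OF p] in \<open>simp add: K_operator_frame_bounds_def l2_ip_def\<close>)
    ultimately have "A p * norm (ip (?K x) (?K x)) \<le> C\<^sup>2 * norm (gram M ?f)"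
      using Ap by simp
    then show ?thesis
      using Ap by (simp add: field_simps)
  qed
  have "operator_family M ip ?F"
    unfolding operator_family_def
  proof (intro conjI ballI allI)
    show "?F w \<in> adjointables ip" if "w \<in> space M" for w
      using R that by (intro adjointable_sum) (auto simp: operator_family_def)
    show "strongly_measurable M (\<lambda>w. ?F w x)" for x
      using F_l2 by (simp add: l2_space_def)
  qed
  with K F_bdd low show ?thesis
    by (intro frame_if_norm_bounds)
qed

end
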